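(* Let $\mathcal{G}$ be $so(2l+1)$ or $sp(l)$ and $2\le p\le l$, or let $\mathcal{G}=so(2l)$ and $2\le p\le l-1$, and let $\Omega^{(4p-1)}$ be the primitive $(4p-1)$-cocycle of $\mathcal{G}$. Then $$\Omega^{(4p-1)}_{i_1\dots i_{4p-1}}=\frac{1}{(4p-1)!}\,\epsilon_{i_1\dots i_{4p-1}}^{j_1\dots j_{4p-1}}\,\Omega^{(4[p-1]-1)}_{j_1\dots j_{4p-6}}{}^{s}\;C^{l_1}_{j_{4p-5}j_{4p-4}}\,C^{l_2}_{j_{4p-3}j_{4p-2}}\,v_{s\,l_1l_2\,j_{4p-1}} .$$
   Context: The generators $X_i$ are taken in the defining matrix representation: $X_i\eta=-\eta X_i^t$ with $\eta$ the $n\times n$ euclidean metric ($so(2l+1)=B_l$, $n=2l+1$, $l\ge2$; $so(2l)=D_l$, $n=2l$, $l\ge4$) or symplectic metric ($sp(l)=C_l$, $n=2l$, $l\ge3$). The basis satisfies $\mathrm{Tr}(X_iX_j)=\kappa\delta_{ij}$ and $[X_i,X_j]=C_{ij}^kX_k$; indices are raised and lowered with $\delta_{ij}$, $C_{ijk}$ is totally antisymmetric, and repeated indices are summed. $v_{i_1i_2i_3\sigma}$ is the symmetric invariant tensor defined by $\{X_{i_1},X_{i_2},X_{i_3}\}=v_{i_1i_2i_3}{}^\sigma X_\sigma$, where $\{\cdot,\cdot,\cdot\}$ is the sum of the $6$ products over all orderings. The higher tensors of the $v$-family are $v_{i_1i_2}=\delta_{i_1i_2}$ and, for $p\ge2$,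 $v_{i_1\dots i_{2p}}=v_{(i_1i_2i_3}{}^{\alpha_1}v_{\alpha_1i_4i_5}{}^{\alpha_2}\cdots v_{\alpha_{p-2}i_{2p-2}i_{2p-1}i_{2p})}$ with unit-weight symmetrisation over the $i$'s. With $\epsilon_{\alpha_1\dots\alpha_N}^{\beta_1\dots\beta_N}=\sum_{\sigma\in S_N}\mathrm{sgn}(\sigma)\,\delta_{\alpha_1}^{\beta_{\sigma(1)}}\cdots\delta_{\alpha_N}^{\beta_{\sigma(N)}}$, the primitive $(4p-1)$-cocycles considered here are $$\Omega^{(4p-1)}_{i_1\dots i_{4p-1}}=\frac{1}{(4p-1)!}\,\epsilon_{i_1\dots i_{4p-1}}^{j_1\dots j_{4p-1}}\,C^{l_1}_{j_1j_2}\cdots C^{l_{2p-1}}_{j_{4p-3}j_{4p-2}}\,v_{l_1\dots l_{2p-1}j_{4p-1}},$$ so that $\Omega^{(3)}_{ijk}=C_{ijk}$. *)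

theory Defs
  imports "HOL-Analysis.Analysis"
begin

definition mscale :: "complex \<Rightarrow> complex^'n^'n \<Rightarrow> complex^'n^'n"
  where "mscale c A = (\<chi> r s. c * A $ r $ s)"

interpretation cmat: vector_space "mscale :: complex \<Rightarrow> complex^'n^'n \<Rightarrow> complex^'n^'n"
  by unfold_locales (simp_all add: mscale_def vec_eq_iff algebra_simps)

definition is_euclidean_metric :: "complex^'n^'n \<Rightarrow> bool"
  where "is_euclidean_metric \<eta> \<longleftrightarrow> \<eta> = mat 1"

definition is_symplectic_metric :: "complex^'n^'n \<Rightarrow> bool"
  where "is_symplectic_metric \<eta> \<longleftrightarrow> transpose \<eta> = - \<eta> \<and> invertible \<eta>"

definition metric_algebra :: "complex^'n^'n \<Rightarrow> (complex^'n^'n) set"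
  where "metric_algebra \<eta> = {A. A ** \<eta> = - (\<eta> ** transpose A)}"

text \<open>A complex basis of the complex Lie algebra.  A real basis of the compact real form is in
  particular such a basis, with the same structure constants.\<close>

definition is_generator_basis ::
    "complex^'n^'n \<Rightarrow> complex \<Rightarrow> ('d::finite \<Rightarrow> complex^'n^'n) \<Rightarrow> bool"
  where "is_generator_basis \<eta> \<kappa> X \<longleftrightarrow>
    inj X \<and> cmat.independent (range X) \<and> cmat.span (range X) = metric_algebra \<eta> \<and>
    (\<forall>i j. trace (X i ** X j) = (if i = j then \<kappa> else 0))"

definition comm :: "complex^'n^'n \<Rightarrow> complex^'n^'n \<Rightarrow> complex^'n^'n"
  where "comm A B = A ** B - B ** A"

definition symprod3 ::
    "complex^'n^'n \<Rightarrow> complex^'n^'n \<Rightarrow> complex^'n^'n \<Rightarrow> complex^'n^'n"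
  where "symprod3 A B C =
    A ** B ** C + A ** C ** B + B ** A ** C + B ** C ** A + C ** A ** B + C ** B ** A"

text \<open>The generator indices are raised and lowered with the Kronecker delta, so no distinction
  is made between upper and lower positions.  The third index of \<open>struct_const X i j k\<close> and the
  fourth one of \<open>v4 X i j k s\<close> are the ones along which the matrices are expanded.\<close>

definition struct_const :: "('d::finite \<Rightarrow> complex^'n^'n) \<Rightarrow> 'd \<Rightarrow> 'd \<Rightarrow> 'd \<Rightarrow> complex"
  where "struct_const X i j k = cmat.representation (range X) (comm (X i) (X j)) (X k)"

definition v4 :: "('d::finite \<Rightarrow> complex^'n^'n) \<Rightarrow> 'd \<Rightarrow> 'd \<Rightarrow> 'd \<Rightarrow> 'd \<Rightarrow> complex"
  where "v4 X i j k s = cmat.representation (range X) (symprod3 (X i) (X j) (X k)) (X s)"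

text \<open>\<^const>\<open>struct_const\<close> and \<^const>\<open>v4\<close> are characterised by
  \<open>[X\<^sub>i, X\<^sub>j] = \<Sum>\<^sub>k C\<^sub>i\<^sub>j\<^sub>k X\<^sub>k\<close> and \<open>{X\<^sub>i, X\<^sub>j, X\<^sub>k} = \<Sum>\<^sub>s v\<^sub>i\<^sub>j\<^sub>k\<^sub>s X\<^sub>s\<close>.\<close>

lemma minus_mult_matrix: "(- A) ** B = - (A ** B)" "B ** (- A) = - (B ** A)"
  for A B :: "complex^'n^'n"
  by (simp_all add: matrix_matrix_mult_def vec_eq_iff sum_negf)

lemma matrix_mult_distrib:
  "(A + B) ** C = A ** C + B ** C" "(A - B) ** C = A ** C - B ** C"
  "C ** (A + B) = C ** A + C ** B" "C ** (A - B) = C ** A - C ** B"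
  for A B C :: "complex^'n^'n"
  by (simp_all add: matrix_matrix_mult_def vec_eq_iff algebra_simps sum.distrib sum_subtractf)

lemma transpose_linear:
  "transpose (A + B) = transpose A + transpose B"
  "transpose (A - B) = transpose A - transpose B"
  for A B :: "complex^'n^'n"
  by (simp_all add: transpose_def vec_eq_iff)

lemma metric_algebra_mult:
  fixes A B \<eta> :: "complex^'n^'n"
  assumes "A ** \<eta> = - (\<eta> ** transpose A)" "B ** \<eta> = - (\<eta> ** transpose B)"
  shows "(A ** B) ** \<eta> = \<eta> ** transpose (B ** A)"
proof -
  have "(A ** B) ** \<eta> = A ** (B ** \<eta>)" by (simp add: matrix_mul_assoc)
  also have "\<dots> = - ((A ** \<eta>) ** transpose B)"
    by (simp add: assms minus_mult_matrix matrix_mul_assoc)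
  also have "\<dots> = \<eta> ** transpose (B ** A)"
    by (simp add: assms minus_mult_matrix matrix_mul_assoc matrix_transpose_mul)
  finally show ?thesis .
qed

lemma metric_algebra_mult3:
  fixes A B C \<eta> :: "complex^'n^'n"
  assumes "A ** \<eta> = - (\<eta> ** transpose A)" "B ** \<eta> = - (\<eta> ** transpose B)"
    "C ** \<eta> = - (\<eta> ** transpose C)"
  shows "(A ** B ** C) ** \<eta> = - (\<eta> ** transpose (C ** B ** A))"
proof -
  have "(A ** B ** C) ** \<eta> = (A ** B) ** (C ** \<eta>)" by (simp add: matrix_mul_assoc)
  also have "\<dots> = - (((A ** B) ** \<eta>) ** transpose C)"
    by (simp add: assms(3) minus_mult_matrix matrix_mul_assoc)
  also have "\<dots> = - (\<eta> ** transpose (C ** B ** A))"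
    by (simp add: metric_algebra_mult[OF assms(1,2)] matrix_mul_assoc matrix_transpose_mul)
  finally show ?thesis .
qed

lemma comm_in_metric_algebra:
  assumes "A \<in> metric_algebra \<eta>" "B \<in> metric_algebra \<eta>"
  shows "comm A B \<in> metric_algebra \<eta>"
proof -
  have A: "A ** \<eta> = - (\<eta> ** transpose A)" and B: "B ** \<eta> = - (\<eta> ** transpose B)"
    using assms by (simp_all add: metric_algebra_def)
  show ?thesis
    unfolding metric_algebra_def comm_def mem_Collect_eq matrix_mult_distrib transpose_linear
      metric_algebra_mult[OF A B] metric_algebra_mult[OF B A]
    by (simp only: minus_diff_eq)
qed

lemma symprod3_in_metric_algebra:
  assumes "A \<in> metric_algebra \<eta>" "B \<in> metric_algebra \<eta>" "C \<in> metric_algebra \<eta>"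
  shows "symprod3 A B C \<in> metric_algebra \<eta>"
proof -
  have A: "A ** \<eta> = - (\<eta> ** transpose A)" and B: "B ** \<eta> = - (\<eta> ** transpose B)"
    and C: "C ** \<eta> = - (\<eta> ** transpose C)"
    using assms by (simp_all add: metric_algebra_def)
  show ?thesis
    unfolding metric_algebra_def symprod3_def mem_Collect_eq matrix_mult_distrib transpose_linear
      metric_algebra_mult3[OF A B C] metric_algebra_mult3[OF A C B]
      metric_algebra_mult3[OF B A C] metric_algebra_mult3[OF B C A]
      metric_algebra_mult3[OF C A B] metric_algebra_mult3[OF C B A]
    by (simp only: minus_add_distrib ac_simps)
qed

lemma generator_expansion:
  assumes "is_generator_basis \<eta> \<kappa> X" "A \<in> metric_algebra \<eta>"
  shows "A = (\<Sum>k\<in>UNIV. mscale (cmat.representation (range X) A (X k)) (X k))"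
proof -
  have "A = (\<Sum>b\<in>range X. mscale (cmat.representation (range X) A b) b)"
    using assms by (intro cmat.sum_representation_eq[symmetric])
      (auto simp: is_generator_basis_def)
  then show ?thesis
    using assms(1) by (simp add: is_generator_basis_def sum.reindex)
qed

lemma generator_in_metric_algebra: "is_generator_basis \<eta> \<kappa> X \<Longrightarrow> X i \<in> metric_algebra \<eta>"
  using cmat.span_base[of "X i" "range X"] by (simp add: is_generator_basis_def)

lemma comm_eq_struct_const:
  assumes "is_generator_basis \<eta> \<kappa> X"
  shows "comm (X i) (X j) = (\<Sum>k\<in>UNIV. mscale (struct_const X i j k) (X k))"
  unfolding struct_const_def
  by (rule generator_expansion[OF assms])
    (intro comm_in_metric_algebra generator_in_metric_algebra[OF assms])

lemma symprod3_eq_v4: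
  assumes "is_generator_basis \<eta> \<kappa> X"
  shows "symprod3 (X i) (X j) (X k) = (\<Sum>s\<in>UNIV. mscale (v4 X i j k s) (X s))"
  unfolding v4_def
  by (rule generator_expansion[OF assms])
    (intro symprod3_in_metric_algebra generator_in_metric_algebra[OF assms])

text \<open>A multi-index of rank \<open>N\<close> is a function on \<^typ>\<open>nat\<close> of which only the values at the
  positions \<open>1, \<dots>, N\<close> matter.\<close>

definition gen_kronecker :: "nat \<Rightarrow> (nat \<Rightarrow> 'd) \<Rightarrow> (nat \<Rightarrow> 'd) \<Rightarrow> complex"
  where "gen_kronecker N \<alpha> \<beta> =
    (\<Sum>\<sigma> | \<sigma> permutes {1..N}. of_int (sign \<sigma>) *
       (\<Prod>m\<in>{1..N}. if \<alpha> m = \<beta> (\<sigma> m) then 1 else 0))"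

text \<open>\<open>v_chain X m i a\<close> is the product of \<open>m\<close> factors
  \<open>v(i\<^sub>1, i\<^sub>2, i\<^sub>3, \<alpha>\<^sub>1) v(\<alpha>\<^sub>1, i\<^sub>4, i\<^sub>5, \<alpha>\<^sub>2) \<dots> v(\<alpha>\<^sub>m\<^sub>-\<^sub>1, i\<^sub>2\<^sub>m, i\<^sub>2\<^sub>m\<^sub>+\<^sub>1, a)\<close>
  summed over \<open>\<alpha>\<^sub>1, \<dots>, \<alpha>\<^sub>m\<^sub>-\<^sub>1\<close>.  The empty product is the Kronecker delta of \<open>i\<^sub>1\<close> and \<open>a\<close>,
  which yields the rank two member of the family.\<close>

primrec v_chain ::
    "('d::finite \<Rightarrow> complex^'n^'n) \<Rightarrow> nat \<Rightarrow> (nat \<Rightarrow> 'd) \<Rightarrow> 'd \<Rightarrow> complex"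
  where
    "v_chain X 0 i a = (if i 1 = a then 1 else 0)"
  | "v_chain X (Suc m) i a =
       (\<Sum>b\<in>UNIV. v_chain X m i b * v4 X b (i (2 * m + 2)) (i (2 * m + 3)) a)"

text \<open>The member of rank \<open>2p\<close>; meaningful for \<open>p \<ge> 1\<close> only.\<close>

definition v_tensor :: "('d::finite \<Rightarrow> complex^'n^'n) \<Rightarrow> nat \<Rightarrow> (nat \<Rightarrow> 'd) \<Rightarrow> complex"
  where "v_tensor X p i =
    (\<Sum>\<pi> | \<pi> permutes {1..2 * p}. v_chain X (p - 1) (i \<circ> \<pi>) (i (\<pi> (2 * p)))) / fact (2 * p)"

lemma v_tensor_1: "v_tensor X 1 i = (if i 1 = i 2 then 1 else 0)"
proof -
  have "v_chain X 0 (i \<circ> \<pi>) (i (\<pi> 2)) = (if i 1 = i 2 then 1 else 0)"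
    if "\<pi> permutes {1..2}" for \<pi>
  proof -
    have eq: "{1..2} = {1, 2::nat}" by auto
    have "\<pi> 1 \<in> {1, 2}" "\<pi> 2 \<in> {1, 2}"
      using permutes_in_image[OF that, of 1] permutes_in_image[OF that, of 2] unfolding eq by blast+
    moreover have "\<pi> 1 \<noteq> \<pi> 2"
      using injD[OF permutes_inj[OF that], of 1 2] by linarith
    ultimately have "(\<pi> 1 = 1 \<and> \<pi> 2 = 2) \<or> (\<pi> 1 = 2 \<and> \<pi> 2 = 1)"
      by (elim insertE emptyE) simp_all
    then show ?thesis
      unfolding v_chain.simps o_def by auto
  qed
  moreover have "card {\<pi>. \<pi> permutes {1..2::nat}} = 2"
    by (subst card_permutations[of _ 2]) simp_all
  ultimately show ?thesis
    by (simp add: v_tensor_def)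
qed

lemma v_chain_1: "v_chain X 1 i a = v4 X (i 1) (i 2) (i 3) a"
  by (simp add: if_distrib[of "\<lambda>x. x * _"] numeral_eq_Suc cong: if_cong)

text \<open>The cocycle of order \<open>4p - 1\<close>; meaningful for \<open>p \<ge> 1\<close> only.  The multi-index of
  \<open>v\<close> is \<open>(l\<^sub>1, \<dots>, l\<^sub>2\<^sub>p\<^sub>-\<^sub>1, j\<^sub>4\<^sub>p\<^sub>-\<^sub>1)\<close>.\<close>

definition Omega :: "('d::finite \<Rightarrow> complex^'n^'n) \<Rightarrow> nat \<Rightarrow> (nat \<Rightarrow> 'd) \<Rightarrow> complex"
  where "Omega X p i =
    (\<Sum>j \<in> {1..4 * p - 1} \<rightarrow>\<^sub>E UNIV.
       gen_kronecker (4 * p - 1) i j *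
       (\<Sum>l \<in> {1..2 * p - 1} \<rightarrow>\<^sub>E UNIV.
          (\<Prod>m\<in>{1..2 * p - 1}. struct_const X (j (2 * m - 1)) (j (2 * m)) (l m)) *
          v_tensor X p (l(2 * p := j (4 * p - 1)))))
    / fact (4 * p - 1)"

end

theory Submission
  imports Defs
begin

text \<open>Let \<open>A\<close> be the matrix of anticommuting one-forms \<open>\<theta>\<^sup>i X\<^sub>i\<close>.  The entries of
  \<open>M = [X\<^sub>j, X\<^sub>k] \<theta>\<^sup>j \<theta>\<^sup>k = 2 A\<^sup>2\<close> have even degree and commute, so contracting \<open>v\<close> with copies
  of \<open>M\<close> turns every symmetrised triple product into \<open>6 M\<^sup>3\<close>.  Hence \<open>\<Omega>\<close> of order \<open>4p - 1\<close> is
  \<open>6\<^sup>p\<^sup>-\<^sup>1 tr (M\<^sup>2\<^sup>p\<^sup>-\<^sup>1 A) / \<kappa>\<close>.  By cyclicity of the trace on words of odd length, leaving the last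
  index \<open>s\<close> of the previous cocycle open yields the coordinates of \<open>6\<^sup>p\<^sup>-\<^sup>2 M\<^sup>2\<^sup>p\<^sup>-\<^sup>3\<close>, an element of the Lie
  algebra, and the last tensor \<open>v\<close> multiplies it by \<open>6 M\<^sup>2\<close>.  Forms are represented by alternating
  sums over permutations of the argument positions.\<close>

subsection \<open>Signed sums over permutations\<close>

text \<open>Symmetrisation for \<open>e = 0\<close>, antisymmetrisation for \<open>e = 1\<close>, both without a factor
  \<open>1 / N!\<close>.\<close>

definition psum :: "nat \<Rightarrow> nat \<Rightarrow> ((nat \<Rightarrow> 'a) \<Rightarrow> 'b::real_vector) \<Rightarrow> (nat \<Rightarrow> 'a) \<Rightarrow> 'b"
  where "psum e N T i =
    (\<Sum>\<sigma> | \<sigma> permutes {1..N}. real_of_int (sign \<sigma> ^ e) *\<^sub>R T (i \<circ> \<sigma>))"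

lemma sign_compose_permutes:
  assumes "\<sigma> permutes {1..N::nat}" "\<tau> permutes {1..N}"
  shows "sign (\<sigma> \<circ> \<tau>) = sign \<sigma> * sign \<tau>"
  using assms by (intro sign_compose permutes_imp_permutation[of "{1..N}"]) auto

lemma permutes_atLeastAtMost_mono:
  "\<sigma> permutes {1..M::nat} \<Longrightarrow> M \<le> N \<Longrightarrow> \<sigma> permutes {1..N}"
  by (rule permutes_subset) auto

lemma psum_cong:
  assumes "\<And>\<sigma>. \<sigma> permutes {1..N} \<Longrightarrow> S (i \<circ> \<sigma>) = T (i \<circ> \<sigma>)"
  shows "psum e N S i = psum e N T i"
  using assms by (simp add: psum_def)

lemma psum_linear:
  assumes "linear f"
  shows "psum e N (\<lambda>j. f (T j)) i = f (psum e N T i)"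
  using assms by (simp add: psum_def linear_sum linear_cmul)

lemma psum_scaleR: "psum e N (\<lambda>j. c *\<^sub>R T j) i = c *\<^sub>R psum e N T i"
  by (rule psum_linear) (rule linear_scale_self)

lemma psum_add: "psum e N (\<lambda>j. S j + T j) i = psum e N S i + psum e N T i"
  by (simp add: psum_def scaleR_right_distrib sum.distrib)

lemma psum_diff: "psum e N (\<lambda>j. S j - T j) i = psum e N S i - psum e N T i"
  by (simp add: psum_def scaleR_right_diff_distrib sum_subtractf)

lemma psum_sum: "psum e N (\<lambda>j. \<Sum>x\<in>A. T x j) i = (\<Sum>x\<in>A. psum e N (T x) i)"
  unfolding psum_def scaleR_sum_right by (rule sum.swap)

lemma sign_power_square: "real_of_int (sign \<sigma> ^ e) * real_of_int (sign \<sigma> ^ e) = 1"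
  by (simp flip: of_int_mult power_mult_distrib)

text \<open>Reindexing the sum by \<open>\<sigma> \<circ> \<rho>\<close> multiplies every sign by
  that of \<rho>; for \<open>e = 0\<close> the factor is 1.\<close>

lemma psum_compose:
  assumes "\<rho> permutes {1..N}"
  shows "psum e N (\<lambda>j. T (j \<circ> \<rho>)) i = real_of_int (sign \<rho> ^ e) *\<^sub>R psum e N T i"
proof -
  have "psum e N T i = (\<Sum>\<sigma> | \<sigma> permutes {1..N}.
      real_of_int (sign (\<sigma> \<circ> \<rho>) ^ e) *\<^sub>R T (i \<circ> (\<sigma> \<circ> \<rho>)))"
    unfolding psum_def by (rule sum_permutations_compose_right[OF assms])
  also have "\<dots> = (\<Sum>\<sigma> | \<sigma> permutes {1..N}.
      real_of_int (sign \<rho> ^ e) *\<^sub>R real_of_int (sign \<sigma> ^ e) *\<^sub>R T (i \<circ> \<sigma> \<circ> \<rho>))"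
    by (intro sum.cong refl)
      (simp add: sign_compose_permutes[OF _ assms] power_mult_distrib o_assoc mult.commute)
  also have "\<dots> = real_of_int (sign \<rho> ^ e) *\<^sub>R psum e N (\<lambda>j. T (j \<circ> \<rho>)) i"
    unfolding psum_def scaleR_sum_right by simp
  finally show ?thesis
    using sign_power_square[of \<rho> e] by (metis scaleR_one scaleR_scaleR)
qed

text \<open>A permutation of the first \<open>M\<close> positions also permutes all \<open>N\<close>
  positions, so the outer sum absorbs it together with its sign, and the \<open>M!\<close> inner
  terms contribute equally.\<close>

lemma psum_psum:
  assumes "M \<le> N"
  shows "psum e N (psum e M T) i = fact M *\<^sub>R psum e N T i"
proof -
  have "psum e N (psum e M T) i =
      (\<Sum>\<tau> | \<tau> permutes {1..M}. real_of_int (sign \<tau> ^ e) *\<^sub>R psum e N (\<lambda>j. T (j \<circ> \<tau>)) i)"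
    unfolding psum_def[of e M] psum_sum psum_scaleR ..
  also have "\<dots> = (\<Sum>\<tau> | \<tau> permutes {1..M}. psum e N T i)"
  proof (intro sum.cong refl, unfold mem_Collect_eq)
    fix \<tau> assume "\<tau> permutes {1..M}"
    then have "\<tau> permutes {1..N}"
      using assms by (rule permutes_atLeastAtMost_mono)
    then show "real_of_int (sign \<tau> ^ e) *\<^sub>R psum e N (\<lambda>j. T (j \<circ> \<tau>)) i = psum e N T i"
      using sign_power_square[of \<tau> e] by (simp add: psum_compose)
  qed
  also have "\<dots> = fact M *\<^sub>R psum e N T i"
    by (simp add: sum_constant_scaleR card_permutations[of _ M])
  finally show ?thesis .
qed

text \<open>Tool for rewriting under a sum over permutations: a replacement that is valid after
  summing over the first \<open>M\<close> positions is valid after summing over all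
  \<open>N\<close>, since the factor \<open>M!\<close> of \<open>psum_psum\<close> cancels.\<close>

lemma psum_sub_eqI:
  assumes "M \<le> N" "\<And>j. psum e M S j = psum e M T j"
  shows "psum e N S i = psum e N T i"
proof -
  have "psum e N (psum e M S) i = psum e N (psum e M T) i"
    by (intro psum_cong assms(2))
  then show ?thesis
    by (simp add: psum_psum[OF assms(1)])
qed

section \<open>The cyclic shift and sums of cyclically invariant expressions\<close>

definition cyc :: "nat \<Rightarrow> nat \<Rightarrow> nat"
  where "cyc N m = (if m \<in> {1..N} then if m = 1 then N else m - 1 else m)"

text \<open>One more adjacent transposition lengthens the cycle by one point; the permutation
  property and the sign follow from this by induction.\<close>

lemma cyc_Suc_Suc: "cyc (Suc (Suc n)) = Transposition.transpose (Suc n) (Suc (Suc n)) \<circ> cyc (Suc n)"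
  by (rule ext) (auto simp: cyc_def Transposition.transpose_def)

lemma cyc_0_1: "cyc 0 = id" "cyc (Suc 0) = id"
  by (auto simp: cyc_def fun_eq_iff)

lemma cyc_permutes: "cyc N permutes {1..N}"
proof (cases N)
  case (Suc n)
  have "cyc (Suc n) permutes {1..Suc n}"
  proof (induction n)
    case (Suc n)
    have "Transposition.transpose (Suc n) (Suc (Suc n)) permutes {1..Suc (Suc n)}"
      by (rule permutes_swap_id) auto
    moreover have "cyc (Suc n) permutes {1..Suc (Suc n)}"
      using Suc by (rule permutes_atLeastAtMost_mono) simp
    ultimately show ?case
      unfolding cyc_Suc_Suc by (intro permutes_compose)
  qed (simp only: cyc_0_1 permutes_id)
  then show ?thesis by (simp add: Suc)
qed (simp only: cyc_0_1 permutes_id)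

lemma sign_cyc: "sign (cyc (Suc n)) = (- 1) ^ n"
proof (induction n)
  case (Suc n)
  have "permutation (cyc (Suc n))"
    using cyc_permutes by (rule permutes_imp_permutation[rotated]) simp
  then show ?case
    by (simp only: cyc_Suc_Suc sign_compose permutation_swap_id sign_swap_id Suc) simp
qed (simp add: cyc_0_1 sign_id)

lemma cyc_funpow_last: "k < N \<Longrightarrow> (cyc N ^^ k) N = N - k"
  by (induction k) (auto simp: cyc_def)

lemma permutes_Suc_fixing: "{\<sigma>. \<sigma> permutes {1..Suc n} \<and> \<sigma> (Suc n) = Suc n} = {\<sigma>. \<sigma> permutes {1..n}}"
proof (intro set_eqI iffI; unfold mem_Collect_eq)
  fix \<sigma> :: "nat \<Rightarrow> nat"
  assume "\<sigma> permutes {1..Suc n} \<and> \<sigma> (Suc n) = Suc n"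
  moreover from this have "\<sigma> m = m" if "m \<in> {1..Suc n} - {1..n}" for m
    using that by (cases "m = Suc n") auto
  ultimately show "\<sigma> permutes {1..n}"
    using permutes_superset[of \<sigma> "{1..Suc n}" "{1..n}"] by blast
next
  fix \<sigma> :: "nat \<Rightarrow> nat"
  assume "\<sigma> permutes {1..n}"
  then show "\<sigma> permutes {1..Suc n} \<and> \<sigma> (Suc n) = Suc n"
    using permutes_atLeastAtMost_mono[of \<sigma> n "Suc n"] permutes_not_in[of \<sigma> "{1..n}" "Suc n"] by simp
qed

text \<open>Sorting the permutations by the position that they send to \<open>Suc n\<close> gives
  \<open>Suc n\<close> fibres, and powers of the shift carry each of them to the fibre of the
  permutations fixing \<open>Suc n\<close>. The summands are preserved because the shift has sign
  \<open>(- 1) ^ n\<close>, whose power \<open>e\<close> is 1 by assumption. In a trace this moves a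
  chosen factor to the end.\<close>

lemma psum_cyclic:
  assumes cyclic: "\<And>j. T (j \<circ> cyc (Suc n)) = T j" and "e = 0 \<or> even n"
  shows "psum e (Suc n) T i = real (Suc n) *\<^sub>R psum e n T i"
proof -
  define N where "N = Suc n"
  define S where "S = {\<sigma>. \<sigma> permutes {1..N}}"
  define g where "g \<sigma> = real_of_int (sign \<sigma> ^ e) *\<^sub>R T (i \<circ> \<sigma>)" for \<sigma>
  have sgn: "sign (cyc N) ^ e = 1"
    using assms(2) by (auto simp: sign_cyc N_def power_mult)
  have perm: "(cyc N ^^ k) permutes {1..N}" for k
    by (induction k) (simp_all only: funpow.simps permutes_id permutes_compose[OF _ cyc_permutes])
  have step: "g (\<sigma> \<circ> cyc N) = g \<sigma>" if "\<sigma> \<in> S" for \<sigma>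
  proof -
    have "sign (\<sigma> \<circ> cyc N) ^ e = sign \<sigma> ^ e"
      using that sgn sign_compose_permutes[OF _ cyc_permutes] by (simp add: S_def power_mult_distrib)
    moreover have "T (i \<circ> (\<sigma> \<circ> cyc N)) = T (i \<circ> \<sigma>)"
      unfolding o_assoc N_def by (rule cyclic)
    ultimately show ?thesis by (simp only: g_def)
  qed
  have inv: "g (\<sigma> \<circ> cyc N ^^ k) = g \<sigma>" if "\<sigma> \<in> S" for \<sigma> k
  proof (induction k)
    case (Suc k)
    have "\<sigma> \<circ> cyc N ^^ k \<in> S"
      using that perm by (auto simp: S_def intro: permutes_compose)
    from step[OF this] show ?case
      using Suc by (simp only: funpow_Suc_right o_assoc)
  qed simp
  have fibre: "(\<Sum>\<sigma> | \<sigma> \<in> S \<and> \<sigma> m = N. g \<sigma>) = (\<Sum>\<sigma> | \<sigma> \<in> S \<and> \<sigma> N = N. g \<sigma>)"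
    if m: "m \<in> {1..N}" for m
  proof -
    \<comment> \<open>This power of the shift sends \<open>N\<close> to \<open>m\<close>, so
      \<open>\<sigma> m = N\<close> becomes \<open>(\<sigma> \<circ> c) N = N\<close>.\<close>
    define c where "c = cyc N ^^ (N - m)"
    have c: "c permutes {1..N}" "c N = m"
      using perm m cyc_funpow_last[of "N - m" N] by (auto simp: c_def)
    note inv_c = permutes_inv[OF c(1)] permutes_inv_o[OF c(1)] permutes_inverses[OF c(1)]
    have "g (\<sigma> \<circ> c) = g \<sigma>" if "\<sigma> \<in> S" for \<sigma>
      unfolding c_def by (rule inv[OF that])
    then show ?thesis
      using c inv_c
      by (intro sum.reindex_bij_witness[of _ "\<lambda>\<sigma>. \<sigma> \<circ> inv c" "\<lambda>\<sigma>. \<sigma> \<circ> c"])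
        (auto simp: S_def o_assoc[symmetric] permutes_compose)
  qed
  have "psum e N T i = (\<Sum>\<sigma>\<in>S. g \<sigma>)"
    by (simp add: psum_def S_def g_def)
  also have "\<dots> = (\<Sum>m\<in>{1..N}. \<Sum>\<sigma> | \<sigma> \<in> S \<and> inv \<sigma> N = m. g \<sigma>)"
  proof (rule sum.group[symmetric])
    show "finite S" by (simp add: S_def finite_permutations)
    show "(\<lambda>\<sigma>. inv \<sigma> N) ` S \<subseteq> {1..N}"
    proof (rule image_subsetI)
      fix \<sigma> assume "\<sigma> \<in> S"
      then have "inv \<sigma> permutes {1..N}" by (auto simp: S_def intro: permutes_inv)
      from permutes_in_image[OF this, of N] show "inv \<sigma> N \<in> {1..N}" by (simp add: N_def)
    qed
  qed simp
  also have "\<dots> = (\<Sum>m\<in>{1..N}. \<Sum>\<sigma> | \<sigma> \<in> S \<and> \<sigma> m = N. g \<sigma>)"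
    by (intro sum.cong refl) (auto simp: S_def permutes_inv_eq permutes_inverses)
  also have "\<dots> = (\<Sum>m\<in>{1..N}. \<Sum>\<sigma> | \<sigma> \<in> S \<and> \<sigma> N = N. g \<sigma>)"
    by (intro sum.cong refl fibre) auto
  also have "\<dots> = real N *\<^sub>R (\<Sum>\<sigma> | \<sigma> \<in> S \<and> \<sigma> N = N. g \<sigma>)"
    by (simp add: sum_constant_scaleR)
  also have "(\<Sum>\<sigma> | \<sigma> \<in> S \<and> \<sigma> N = N. g \<sigma>) = psum e n T i"
    using permutes_Suc_fixing[of n] by (simp add: psum_def S_def g_def N_def)
  finally show ?thesis by (simp add: N_def)
qed

text \<open>Bridge from contractions with the generalised Kronecker symbol to \<open>psum\<close>.
  The contraction runs over extensional functions, while \<open>psum\<close> permutes an arbitrary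
  total function; \<open>dep\<close> reconciles the two.\<close>

lemma sum_gen_kronecker:
  fixes T :: "(nat \<Rightarrow> 'd::finite) \<Rightarrow> complex"
  assumes dep: "\<And>j j'. (\<And>m. m \<in> {1..N} \<Longrightarrow> j m = j' m) \<Longrightarrow> T j = T j'"
  shows "(\<Sum>j \<in> {1..N} \<rightarrow>\<^sub>E UNIV. gen_kronecker N i j * T j) = psum 1 N T i"
proof -
  have inner: "(\<Sum>j \<in> {1..N} \<rightarrow>\<^sub>E UNIV.
      (\<Prod>m\<in>{1..N}. if i m = j (\<sigma> m) then 1 else 0) * T j) = T (i \<circ> inv \<sigma>)"
    if \<sigma>: "\<sigma> permutes {1..N}" for \<sigma>
  proof -
    \<comment> \<open>The deltas select one multi-index, cut off outside \<open>{1..N}\<close> so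
      that it lies in the range of summation.\<close>
    define k where "k = restrict (i \<circ> inv \<sigma>) {1..N}"
    have k: "k \<in> {1..N} \<rightarrow>\<^sub>E UNIV" by (simp add: k_def)
    have *: "(\<Prod>m\<in>{1..N}. if i m = j (\<sigma> m) then 1 else 0) = (if j = k then 1 else (0::complex))"
      if j: "j \<in> {1..N} \<rightarrow>\<^sub>E UNIV" for j
    proof (cases "j = k")
      case True
      have "i m = k (\<sigma> m)" if "m \<in> {1..N}" for m
        using permutes_in_image[OF \<sigma>, of m] that
        by (simp add: k_def permutes_inverses[OF \<sigma>])
      then show ?thesis using True by simp
    next
      case False
      then obtain m where m: "m \<in> {1..N}" "j m \<noteq> k m"
        using j k by (metis PiE_ext)
      then have "inv \<sigma> m \<in> {1..N}" "i (inv \<sigma> m) \<noteq> j (\<sigma> (inv \<sigma> m))"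
        using permutes_in_image[OF permutes_inv[OF \<sigma>], of m]
        by (simp_all add: k_def permutes_inverses[OF \<sigma>])
      then show ?thesis using False by (auto intro!: bexI[of _ "inv \<sigma> m"])
    qed
    have "(\<Sum>j \<in> {1..N} \<rightarrow>\<^sub>E UNIV.
        (\<Prod>m\<in>{1..N}. if i m = j (\<sigma> m) then 1 else 0) * T j)
      = (\<Sum>j \<in> {1..N} \<rightarrow>\<^sub>E UNIV. if j = k then T j else 0)"
      by (intro sum.cong refl) (subst *, assumption, simp)
    also have "\<dots> = T k"
      using k by (simp add: finite_PiE)
    also have "\<dots> = T (i \<circ> inv \<sigma>)"
      by (rule dep) (simp add: k_def)
    finally show ?thesis .
  qed
  have "(\<Sum>j \<in> {1..N} \<rightarrow>\<^sub>E UNIV. gen_kronecker N i j * T j) =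
      (\<Sum>\<sigma> | \<sigma> permutes {1..N}. of_int (sign \<sigma>) * (\<Sum>j \<in> {1..N} \<rightarrow>\<^sub>E UNIV.
        (\<Prod>m\<in>{1..N}. if i m = j (\<sigma> m) then 1 else 0) * T j))"
    unfolding gen_kronecker_def sum_distrib_left sum_distrib_right
    by (subst sum.swap) (simp add: mult.assoc)
  also have "\<dots> = (\<Sum>\<sigma> | \<sigma> permutes {1..N}. of_int (sign \<sigma>) * T (i \<circ> inv \<sigma>))"
    by (intro sum.cong refl) (simp only: inner mem_Collect_eq)
  \<comment> \<open>A permutation and its inverse have the same sign, so the sum may be run over the
    inverses.\<close>
  also have "\<dots> = (\<Sum>\<sigma> | \<sigma> permutes {1..N}. of_int (sign (inv \<sigma>)) * T (i \<circ> inv \<sigma>))"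
    by (intro sum.cong refl) (auto simp: sign_inverse permutes_imp_permutation[of "{1..N}"])
  also have "\<dots> = psum 1 N T i"
    unfolding psum_def
    by (subst (2) sum_permutations_inverse) (simp add: scaleR_conv_of_real)
  finally show ?thesis .
qed

subsection \<open>Ordered and symmetrised matrix products\<close>

lemma linear_matrix_mult_left: "linear (\<lambda>A :: complex^'n^'n. A ** B)"
  and linear_matrix_mult_right: "linear (\<lambda>A :: complex^'n^'n. B ** A)"
  for B :: "complex^'n^'n"
  by (auto intro!: linearI simp: matrix_mult_distrib scalar_matrix_assoc matrix_scalar_ac)

lemma linear_trace: "linear (trace :: complex^'n^'n \<Rightarrow> complex)"
  by (auto intro!: linearI simp: trace_add) (simp add: trace_def scaleR_sum_right)

lemma linear_trace_mult: "linear (\<lambda>A :: complex^'n^'n. trace (A ** B))" for B :: "complex^'n^'n"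
  using linear_compose[OF linear_matrix_mult_left linear_trace] by (simp add: o_def)

lemma linear_symprod3: "linear (\<lambda>A. symprod3 A B C)"
  by (auto intro!: linearI
      simp: symprod3_def matrix_mult_distrib scaleR_right_distrib scalar_matrix_assoc matrix_scalar_ac)

primrec mprod :: "(nat \<Rightarrow> complex^'n^'n) \<Rightarrow> nat \<Rightarrow> complex^'n^'n" where
  "mprod Y 0 = mat 1"
| "mprod Y (Suc n) = mprod Y n ** Y (Suc n)"

lemma mprod_cong: "(\<And>m. m \<in> {1..n} \<Longrightarrow> Y m = Z m) \<Longrightarrow> mprod Y n = mprod Z n"
  by (induction n) auto

lemma mprod_Suc_left: "mprod Y (Suc n) = Y 1 ** mprod (\<lambda>m. Y (Suc m)) n"
proof (induction n)
  case (Suc n)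
  have "mprod Y (Suc (Suc n)) = mprod Y (Suc n) ** Y (Suc (Suc n))" by (rule mprod.simps)
  also have "\<dots> = Y 1 ** mprod (\<lambda>m. Y (Suc m)) (Suc n)"
    unfolding Suc by (simp add: matrix_mul_assoc)
  finally show ?case .
qed simp

lemma mprod_cyc: "mprod (Y \<circ> cyc (Suc n)) (Suc n) = Y (Suc n) ** mprod Y n"
proof -
  have "mprod (\<lambda>m. (Y \<circ> cyc (Suc n)) (Suc m)) n = mprod Y n"
    by (rule mprod_cong) (auto simp: cyc_def)
  then show ?thesis
    unfolding mprod_Suc_left by (simp add: cyc_def)
qed

lemma mprod_blocks: "mprod (\<lambda>m. Y (2 * m - 1) ** Y (2 * m)) n = mprod Y (2 * n)"
  by (induction n) (simp_all add: matrix_mul_assoc)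

lemma mprod_diff:
  assumes "m \<in> {1..n}"
  shows "mprod (Y(m := A - B)) n = mprod (Y(m := A)) n - mprod (Y(m := B)) n"
  using assms
proof (induction n)
  case (Suc n)
  have step: "mprod (Y(m := C)) (Suc n) = mprod (Y(m := C)) n ** (if m = Suc n then C else Y (Suc n))"
    for C by (simp del: fun_upd_apply) simp
  show ?case
  proof (cases "m = Suc n")
    case True
    have upd: "mprod (Y(m := C)) n = mprod Y n" for C
      by (rule mprod_cong) (auto simp: True)
    show ?thesis
      unfolding step upd using True by (simp add: matrix_mult_distrib)
  next
    case False
    have IH: "mprod (Y(m := A - B)) n = mprod (Y(m := A)) n - mprod (Y(m := B)) n"
      by (rule Suc.IH) (use Suc.prems False in simp)
    show ?thesis
      unfolding step IH using False by (simp add: matrix_mult_distrib)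
  qed
qed simp

lemma trace_mprod_cyc: "trace (mprod (Y \<circ> cyc (Suc n)) (Suc n)) = trace (mprod Y (Suc n))"
  unfolding mprod_cyc unfolding mprod.simps by (rule trace_mul_sym)

section \<open>Nested symmetrised triple products\<close>

definition orderings3 :: "nat \<Rightarrow> (nat \<Rightarrow> nat) list"
  where "orderings3 k =
    (let c = cyc (k + 2); t = Transposition.transpose (k + 1) (k + 2)
     in [id, c, c \<circ> c, t, t \<circ> c, t \<circ> c \<circ> c])"

lemma orderings3_permutes:
  assumes "\<rho> \<in> set (orderings3 k)"
  shows "\<rho> permutes {1..k + 2}"
proof -
  let ?c = "cyc (k + 2)" and ?t = "Transposition.transpose (k + 1) (k + 2)"
  have c: "?c permutes {1..k + 2}" by (rule cyc_permutes)
  have t: "?t permutes {1..k + 2}" by (rule permutes_swap_id) auto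
  note perms = permutes_id c permutes_compose[OF c c] t permutes_compose[OF c t]
    permutes_compose[OF c permutes_compose[OF c t]]
  from assms show ?thesis
    unfolding orderings3_def Let_def set_simps
    by (elim insertE emptyE) (simp_all only: perms)
qed

lemma length_orderings3: "length (orderings3 k) = 6"
  by (simp add: orderings3_def Let_def)

text \<open>The product of the first \<open>k\<close> matrices acts as one block. Up to two shifts
  by \<open>cyc (k + 2)\<close> move the last factors to the front without splitting the block, and
  the transposition exchanges these two factors. This realises all six orderings of the three
  factors as permutations of the whole word.\<close>

lemma symprod3_mprod:
  "symprod3 (mprod Y k) (Y (k + 1)) (Y (k + 2)) =
    (\<Sum>\<rho>\<leftarrow>orderings3 k. mprod (Y \<circ> \<rho>) (k + 2))"
proof -
  let ?c = "cyc (k + 2)" and ?t = "Transposition.transpose (k + 1) (k + 2)"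
  have init: "mprod (Z \<circ> ?c) (k + 1) = Z (k + 2) ** mprod Z k" for Z :: "nat \<Rightarrow> complex^'n^'n"
  proof -
    have "mprod (\<lambda>m. (Z \<circ> ?c) (Suc m)) k = mprod Z k"
      by (rule mprod_cong) (auto simp: cyc_def)
    then show ?thesis
      unfolding Suc_eq_plus1[symmetric] mprod_Suc_left by (simp add: cyc_def)
  qed
  have cyc1: "mprod (Z \<circ> ?c) (k + 2) = Z (k + 2) ** mprod Z k ** Z (k + 1)"
    for Z :: "nat \<Rightarrow> complex^'n^'n"
    using mprod_cyc[of Z "Suc k"] by (simp add: matrix_mul_assoc)
  have cyc2: "mprod (Z \<circ> ?c \<circ> ?c) (k + 2) = Z (k + 1) ** Z (k + 2) ** mprod Z k"
    for Z :: "nat \<Rightarrow> complex^'n^'n"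
  proof -
    have "mprod (Z \<circ> ?c \<circ> ?c) (k + 2) = (Z \<circ> ?c) (k + 2) ** mprod (Z \<circ> ?c) (k + 1)"
      using mprod_cyc[of "Z \<circ> ?c" "Suc k"] by simp
    also have "(Z \<circ> ?c) (k + 2) = Z (k + 1)"
      by (simp add: cyc_def)
    finally show ?thesis
      by (simp only: init matrix_mul_assoc)
  qed
  have t: "mprod (Y \<circ> ?t) k = mprod Y k" "(Y \<circ> ?t) (k + 1) = Y (k + 2)" "(Y \<circ> ?t) (k + 2) = Y (k + 1)"
    by (auto intro!: mprod_cong simp: Transposition.transpose_def)
  have id: "mprod Z (k + 2) = mprod Z k ** Z (k + 1) ** Z (k + 2)" for Z :: "nat \<Rightarrow> complex^'n^'n"
    by simp
  show ?thesis
    unfolding orderings3_def Let_def list.map sum_list.Cons sum_list.Nil comp_id o_assoc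
      cyc2 symprod3_def
    unfolding cyc1
    unfolding id t
    by (simp only: add.assoc add.left_commute add.commute add_0_right add_0_left)
qed

text \<open>Matrix counterpart of \<open>v_chain\<close>: expanding the inner product in generators
  at every stage produces the chain of tensors \<open>v4\<close>.\<close>

primrec nested_symprod3 :: "nat \<Rightarrow> (nat \<Rightarrow> complex^'n^'n) \<Rightarrow> complex^'n^'n" where
  "nested_symprod3 0 Y = Y 1"
| "nested_symprod3 (Suc m) Y = symprod3 (nested_symprod3 m Y) (Y (2 * m + 2)) (Y (2 * m + 3))"

lemma psum_orderings3:
  assumes "\<And>\<rho>. \<rho> \<in> set (orderings3 k) \<Longrightarrow> psum e N (T \<rho>) i = A"
  shows "psum e N (\<lambda>j. \<Sum>\<rho>\<leftarrow>orderings3 k. T \<rho> j) i = 6 *\<^sub>R A"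
proof -
  have "psum e N (\<lambda>j. \<Sum>\<rho>\<leftarrow>rs. T \<rho> j) i = real (length rs) *\<^sub>R A"
    if "\<forall>\<rho>\<in>set rs. psum e N (T \<rho>) i = A" for rs
    using that
  proof (induction rs)
    case Nil
    show ?case by (simp add: psum_def)
  next
    case (Cons r rs)
    then show ?case by (simp add: psum_add scaleR_left_distrib)
  qed
  from this[of "orderings3 k"] assms show ?thesis by (simp add: length_orderings3)
qed

text \<open>After symmetrisation the six orderings in each triple product agree, since each is a
  permutation of one and the same word; every nesting level therefore contributes a factor
  6.\<close>

lemma psum_nested_symprod3:
  fixes Y :: "nat \<Rightarrow> complex^'n^'n"
  shows "psum 0 (2 * m + 1) (nested_symprod3 m) Y = 6 ^ m *\<^sub>R psum 0 (2 * m + 1) (\<lambda>Y. mprod Y (2 * m + 1)) Y"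
proof (induction m arbitrary: Y)
  case 0
  show ?case by simp
next
  case (Suc m)
  let ?M = "2 * m + 1" and ?N = "2 * m + 3"
  \<comment> \<open>The induction hypothesis is applied inside \<open>symprod3\<close>, which is
    linear in its first argument. Permutations of the first \<open>?M\<close> positions leave the
    two outer factors in place.\<close>
  have "psum 0 ?N (nested_symprod3 (Suc m)) Y =
     psum 0 ?N (\<lambda>Y. symprod3 (6 ^ m *\<^sub>R mprod Y ?M) (Y (?M + 1)) (Y (?M + 2))) Y"
  proof (rule psum_sub_eqI[of ?M])
    fix Y :: "nat \<Rightarrow> complex^'n^'n"
    have "psum 0 ?M (nested_symprod3 (Suc m)) Y =
      psum 0 ?M (\<lambda>Z. symprod3 (nested_symprod3 m Z) (Y (?M + 1)) (Y (?M + 2))) Y"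
      by (rule psum_cong) (simp add: permutes_not_in numeral_3_eq_3)
    also have "\<dots> = symprod3 (psum 0 ?M (nested_symprod3 m) Y) (Y (?M + 1)) (Y (?M + 2))"
      by (rule psum_linear[OF linear_symprod3])
    also have "psum 0 ?M (nested_symprod3 m) Y = psum 0 ?M (\<lambda>Z. 6 ^ m *\<^sub>R mprod Z ?M) Y"
      unfolding psum_scaleR by (rule Suc)
    also have "symprod3 \<dots> (Y (?M + 1)) (Y (?M + 2)) =
      psum 0 ?M (\<lambda>Z. symprod3 (6 ^ m *\<^sub>R mprod Z ?M) (Y (?M + 1)) (Y (?M + 2))) Y"
      by (rule psum_linear[OF linear_symprod3, symmetric])
    also have "\<dots> = psum 0 ?M (\<lambda>Y. symprod3 (6 ^ m *\<^sub>R mprod Y ?M) (Y (?M + 1)) (Y (?M + 2))) Y"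
      by (rule psum_cong) (simp add: permutes_not_in)
    finally show "psum 0 ?M (nested_symprod3 (Suc m)) Y = \<dots>" .
  qed simp
  also have "\<dots> = 6 ^ m *\<^sub>R psum 0 ?N (\<lambda>Y. \<Sum>\<rho>\<leftarrow>orderings3 ?M. mprod (Y \<circ> \<rho>) (?M + 2)) Y"
    unfolding linear_cmul[OF linear_symprod3] symprod3_mprod by (rule psum_scaleR)
  also have "psum 0 ?N (\<lambda>Y. \<Sum>\<rho>\<leftarrow>orderings3 ?M. mprod (Y \<circ> \<rho>) (?M + 2)) Y =
    6 *\<^sub>R psum 0 ?N (\<lambda>Y. mprod Y (?M + 2)) Y"
  proof (rule psum_orderings3)
    fix \<rho> and Y :: "nat \<Rightarrow> complex^'n^'n"
    assume "\<rho> \<in> set (orderings3 ?M)"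
    from orderings3_permutes[OF this] have "\<rho> permutes {1..?N}"
      by (simp add: numeral_3_eq_3)
    from psum_compose[OF this, of 0 "\<lambda>Y. mprod Y (?M + 2)" Y]
    show "psum 0 ?N (\<lambda>Y. mprod (Y \<circ> \<rho>) (?M + 2)) Y = psum 0 ?N (\<lambda>Y. mprod Y (?M + 2)) Y"
      by simp
  qed
  finally show ?case
    by (simp add: numeral_3_eq_3 mult.commute)
qed

subsection \<open>Alternating products of commutators\<close>

text \<open>Rewriting inside a context \<open>f\<close> that is linear in the matrix and unchanged
  by permutations of the first \<open>M\<close> positions: the sum over these positions can be moved
  inside \<open>f\<close>, where \<open>S\<close> and \<open>T\<close> have equal sums.\<close>

lemma psum_lift:
  assumes "M \<le> N" "\<And>j. psum e M S j = psum e M T j" "\<And>j. linear (\<lambda>A. f A j)"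
    and dep: "\<And>A j \<sigma>. \<sigma> permutes {1..M} \<Longrightarrow> f A (j \<circ> \<sigma>) = f A j"
  shows "psum e N (\<lambda>j. f (S j) j) i = psum e N (\<lambda>j. f (T j) j) i"
proof (rule psum_sub_eqI[OF assms(1)])
  fix j
  have *: "psum e M (\<lambda>j. f (U j) j) j = f (psum e M U j) j" for U
  proof -
    have "psum e M (\<lambda>j. f (U j) j) j = psum e M (\<lambda>k. f (U k) j) j"
      by (rule psum_cong) (rule dep)
    also have "\<dots> = f (psum e M U j) j"
      by (rule psum_linear) (rule assms(3))
    finally show ?thesis .
  qed
  show "psum e M (\<lambda>j. f (S j) j) j = psum e M (\<lambda>j. f (T j) j) j"
    unfolding * assms(2) ..
qed

text \<open>Exchanging two pairs takes one transposition of odd positions and one of even positions,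
  so it is an even permutation. Writing \<pi> as a product of transpositions gives the general
  case.\<close>

lemma permutation_of_pairs:
  assumes "\<pi> permutes {1..K::nat}"
  shows "\<exists>\<beta>. \<beta> permutes {1..2 * K} \<and> sign \<beta> = 1 \<and>
    (\<forall>m\<in>{1..K}. \<beta> (2 * m - 1) = 2 * \<pi> m - 1 \<and> \<beta> (2 * m) = 2 * \<pi> m)"
  using assms finite_atLeastAtMost
proof (induction rule: permutes_induct)
  case id
  show ?case
    by (intro exI[of _ id] conjI permutes_id) (simp_all add: sign_id)
next
  case (swap a b p)
  from swap.IH obtain \<beta> where \<beta>: "\<beta> permutes {1..2 * K}" "sign \<beta> = 1"
    "\<And>m. m \<in> {1..K} \<Longrightarrow> \<beta> (2 * m - 1) = 2 * p m - 1 \<and> \<beta> (2 * m) = 2 * p m"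
    by (elim exE conjE) (simp only:)
  let ?s = "Transposition.transpose (2 * a - 1) (2 * b - 1)" and ?t = "Transposition.transpose (2 * a) (2 * b)"
  have s: "?s permutes {1..2 * K}" and t: "?t permutes {1..2 * K}"
    using swap.hyps(1,2) by (auto intro!: permutes_swap_id)
  have sign_s: "sign ?s = - 1" and sign_t: "sign ?t = - 1"
    using swap.hyps(1-3) by (auto simp: sign_swap_id)
  have "?s \<circ> (?t \<circ> \<beta>) permutes {1..2 * K}"
    by (rule permutes_compose[OF permutes_compose[OF \<beta>(1) t] s])
  moreover have "sign (?s \<circ> (?t \<circ> \<beta>)) = 1"
    using sign_compose_permutes[OF s permutes_compose[OF \<beta>(1) t]] sign_compose_permutes[OF t \<beta>(1)]
    unfolding \<beta>(2) sign_s sign_t by simp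
  moreover have "(?s \<circ> (?t \<circ> \<beta>)) (2 * m - 1) = 2 * (Transposition.transpose a b \<circ> p) m - 1 \<and>
      (?s \<circ> (?t \<circ> \<beta>)) (2 * m) = 2 * (Transposition.transpose a b \<circ> p) m"
    if m: "m \<in> {1..K}" for m
  proof -
    have "p m \<in> {1..K}"
      using permutes_in_image[OF \<open>p permutes {1..K}\<close>, of m] m by simp
    then have ge: "1 \<le> p m" "1 \<le> a" "1 \<le> b"
      using swap.hyps(1,2) by auto
    have odd_eq: "2 * x - 1 = 2 * y - 1 \<longleftrightarrow> x = y" if "1 \<le> x" "1 \<le> y" for x y :: nat
      using that by linarith
    have odd_even: "2 * x - 1 \<noteq> 2 * y" if "1 \<le> x" for x y :: nat
      using that by presburger
    have "?s (2 * x) = 2 * x" for x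
      unfolding Transposition.transpose_def
      using odd_even[OF ge(2), of x, symmetric] odd_even[OF ge(3), of x, symmetric] by (simp only: if_False)
    moreover have "?t (2 * p m - 1) = 2 * p m - 1"
      unfolding Transposition.transpose_def
      using odd_even[OF ge(1)] by (simp only: if_False)
    moreover have "?s (2 * p m - 1) = 2 * Transposition.transpose a b (p m) - 1"
      unfolding Transposition.transpose_def odd_eq[OF ge(1,2)] odd_eq[OF ge(1,3)] by simp
    moreover have "?t (2 * p m) = 2 * Transposition.transpose a b (p m)"
      by (simp add: Transposition.transpose_def)
    ultimately show ?thesis
      by (simp only: o_apply conjunct1[OF \<beta>(3)[OF m]] conjunct2[OF \<beta>(3)[OF m]])
  qed
  ultimately show ?case
    by (intro exI[of _ "?s \<circ> (?t \<circ> \<beta>)"] conjI[OF _ conjI] ballI)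
qed

definition pair_comm :: "('d \<Rightarrow> complex^'n^'n) \<Rightarrow> (nat \<Rightarrow> 'd) \<Rightarrow> nat \<Rightarrow> complex^'n^'n"
  where "pair_comm X j m = comm (X (j (2 * m - 1))) (X (j (2 * m)))"

text \<open>Each commutator occupies two positions, so reordering commutators permutes the positions
  evenly. This is the concrete form of the commutation of even-degree forms.\<close>

lemma psum_pair_comm_permute:
  assumes "\<pi> permutes {1..K}"
  shows "psum 1 (2 * K) (\<lambda>j. mprod (pair_comm X j \<circ> \<pi>) K) i = psum 1 (2 * K) (\<lambda>j. mprod (pair_comm X j) K) i"
proof -
  obtain \<beta> where \<beta>: "\<beta> permutes {1..2 * K}" "sign \<beta> = 1"
    "\<And>m. m \<in> {1..K} \<Longrightarrow> \<beta> (2 * m - 1) = 2 * \<pi> m - 1 \<and> \<beta> (2 * m) = 2 * \<pi> m"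
    using permutation_of_pairs[OF assms] by blast
  have "mprod (pair_comm X j \<circ> \<pi>) K = mprod (pair_comm X (j \<circ> \<beta>)) K" for j
    using \<beta>(3) by (intro mprod_cong) (simp add: pair_comm_def)
  then show ?thesis
    using psum_compose[OF \<beta>(1), of 1 "\<lambda>j. mprod (pair_comm X j) K" i] \<beta>(2) by simp
qed

text \<open>Under alternation the two terms of a commutator contribute equally, so the commutators
  can be replaced one at a time by plain products, each with a factor 2.\<close>

lemma psum_pair_comm:
  "psum 1 (2 * K) (\<lambda>j. mprod (pair_comm X j) K) i = 2 ^ K *\<^sub>R psum 1 (2 * K) (\<lambda>j. mprod (X \<circ> j) (2 * K)) i"
proof -
  \<comment> \<open>\<open>Z\<close> interpolates between the product of commutators at
    \<open>r = 0\<close> and the plain word at \<open>r = K\<close>.\<close>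
  define Z where "Z r j m = (if m \<le> r then X (j (2 * m - 1)) ** X (j (2 * m)) else pair_comm X j m)"
    for r j m
  have step: "psum 1 (2 * K) (\<lambda>j. mprod (Z r j) K) i = 2 *\<^sub>R psum 1 (2 * K) (\<lambda>j. mprod (Z (Suc r) j) K) i"
    if r: "r < K" for r
  proof -
    \<comment> \<open>This odd permutation exchanges the two positions of pair \<open>Suc r\<close>;
      its sign cancels the minus sign in the commutator.\<close>
    let ?t = "Transposition.transpose (2 * r + 1) (2 * r + 2)"
    have t: "?t permutes {1..2 * K}"
      using r by (intro permutes_swap_id) auto
    have sign_t: "sign ?t = - 1" by (simp add: sign_swap_id)
    have "mprod (Z r j) K = mprod (Z (Suc r) j) K - mprod (Z (Suc r) (j \<circ> ?t)) K" for j
    proof -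
      let ?A = "X (j (2 * r + 1)) ** X (j (2 * r + 2))" and ?B = "X (j (2 * r + 2)) ** X (j (2 * r + 1))"
      have "Z r j = (Z (Suc r) j)(Suc r := ?A - ?B)"
        by (rule ext) (auto simp: Z_def pair_comm_def comm_def)
      moreover have "Z (Suc r) j = (Z (Suc r) j)(Suc r := ?A)"
        by (rule ext) (auto simp: Z_def)
      moreover have "Z (Suc r) (j \<circ> ?t) = (Z (Suc r) j)(Suc r := ?B)"
      proof (rule ext)
        fix m
        show "Z (Suc r) (j \<circ> ?t) m = ((Z (Suc r) j)(Suc r := ?B)) m"
        proof (cases "m = Suc r")
          case False
          then have "?t (2 * m - 1) = 2 * m - 1" "?t (2 * m) = 2 * m"
            unfolding Transposition.transpose_def by presburger+
          then show ?thesis using False by (simp add: Z_def pair_comm_def)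
        qed (simp add: Z_def)
      qed
      ultimately show ?thesis
        using mprod_diff[of "Suc r" K "Z (Suc r) j" ?A ?B] r by simp
    qed
    then have "psum 1 (2 * K) (\<lambda>j. mprod (Z r j) K) i =
      psum 1 (2 * K) (\<lambda>j. mprod (Z (Suc r) j) K) i - psum 1 (2 * K) (\<lambda>j. mprod (Z (Suc r) (j \<circ> ?t)) K) i"
      by (simp only: psum_diff)
    also have "psum 1 (2 * K) (\<lambda>j. mprod (Z (Suc r) (j \<circ> ?t)) K) i =
      - psum 1 (2 * K) (\<lambda>j. mprod (Z (Suc r) j) K) i"
      using psum_compose[OF t, of 1 "\<lambda>j. mprod (Z (Suc r) j) K" i] unfolding sign_t by simp
    finally show ?thesis by (simp add: scaleR_2)
  qed
  have "r \<le> K \<Longrightarrow> psum 1 (2 * K) (\<lambda>j. mprod (Z 0 j) K) i =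
      2 ^ r *\<^sub>R psum 1 (2 * K) (\<lambda>j. mprod (Z r j) K) i" for r
  proof (induction r)
    case (Suc r)
    then show ?case using step[of r] by (simp add: mult.commute[of 2 "2 ^ r"] flip: scaleR_scaleR)
  qed simp
  from this[of K] have "psum 1 (2 * K) (\<lambda>j. mprod (Z 0 j) K) i =
      2 ^ K *\<^sub>R psum 1 (2 * K) (\<lambda>j. mprod (Z K j) K) i" by simp
  moreover have "mprod (Z 0 j) K = mprod (pair_comm X j) K" for j
    by (rule mprod_cong) (simp add: Z_def)
  moreover have "mprod (Z K j) K = mprod (X \<circ> j) (2 * K)" for j
  proof -
    have "mprod (Z K j) K = mprod (\<lambda>m. (X \<circ> j) (2 * m - 1) ** (X \<circ> j) (2 * m)) K"
      by (rule mprod_cong) (simp add: Z_def)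
    then show ?thesis by (simp only: mprod_blocks)
  qed
  ultimately show ?thesis by simp
qed

subsection \<open>Expansion in generators\<close>

lemma mscale_mult: "mscale c A ** B = mscale c (A ** B)" "A ** mscale c B = mscale c (A ** B)"
  for A B :: "complex^'n^'n"
  by (simp_all add: mscale_def matrix_matrix_mult_def vec_eq_iff sum_distrib_left mult_ac)

lemma trace_mscale: "trace (mscale c A) = c * trace A"
  by (simp add: trace_def mscale_def sum_distrib_left)

lemma mscale_of_real: "mscale (complex_of_real c) A = c *\<^sub>R A"
  by (simp add: mscale_def vec_eq_iff) (simp add: scaleR_conv_of_real)

lemma trace_sum_mult: "trace ((\<Sum>a\<in>S. F a) ** B) = (\<Sum>a\<in>S. trace (F a ** B))"
  for B :: "complex^'n^'n"
  by (rule linear_sum[OF linear_trace_mult])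

lemma symprod3_commute: "symprod3 A B C = symprod3 B A C" "symprod3 A B C = symprod3 C B A"
  by (simp_all add: symprod3_def)

lemma symprod3_sum_mscale:
  "symprod3 (\<Sum>a\<in>S. mscale (f a) (F a)) B C = (\<Sum>a\<in>S. mscale (f a) (symprod3 (F a) B C))"
proof -
  have "symprod3 (mscale c A) B C = mscale c (symprod3 A B C)" for c A
    by (simp add: symprod3_def mscale_mult cmat.scale_right_distrib)
  then show ?thesis
    by (simp add: linear_sum[OF linear_symprod3])
qed

lemma mprod_sum_mscale:
  fixes X :: "'d::finite \<Rightarrow> complex^'n^'n"
  shows "mprod (\<lambda>m. \<Sum>a\<in>UNIV. mscale (c m a) (X a)) K =
    (\<Sum>l\<in>{1..K} \<rightarrow>\<^sub>E UNIV. mscale (\<Prod>m\<in>{1..K}. c m (l m)) (mprod (X \<circ> l) K))"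
proof (induction K)
  case (Suc K)
  have ins: "{1..Suc K} = insert (Suc K) {1..K}" by auto
  have inj: "inj_on (\<lambda>(y, g). g(Suc K := y)) (UNIV \<times> ({1..K} \<rightarrow>\<^sub>E (UNIV :: 'd set)))"
    by (rule inj_combinator) simp
  have "(\<Sum>l\<in>{1..Suc K} \<rightarrow>\<^sub>E UNIV. mscale (\<Prod>m\<in>{1..Suc K}. c m (l m)) (mprod (X \<circ> l) (Suc K))) =
    (\<Sum>(a, l)\<in>UNIV \<times> ({1..K} \<rightarrow>\<^sub>E UNIV).
      mscale (\<Prod>m\<in>{1..Suc K}. c m ((l(Suc K := a)) m)) (mprod (X \<circ> l(Suc K := a)) (Suc K)))"
    unfolding ins PiE_insert_eq by (subst sum.reindex[OF inj]) (simp add: o_def case_prod_beta)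
  also have "\<dots> = (\<Sum>(a, l)\<in>UNIV \<times> ({1..K} \<rightarrow>\<^sub>E UNIV).
      mscale (\<Prod>m\<in>{1..K}. c m (l m)) (mprod (X \<circ> l) K) ** mscale (c (Suc K) a) (X a))"
  proof (intro sum.cong refl, clarify)
    fix a and l :: "nat \<Rightarrow> 'd"
    have "(\<Prod>m\<in>{1..Suc K}. c m ((l(Suc K := a)) m)) = c (Suc K) a * (\<Prod>m\<in>{1..K}. c m (l m))"
      unfolding ins by (subst prod.insert) (auto intro!: prod.cong arg_cong[where f = "\<lambda>x. _ * x"])
    moreover have "mprod (X \<circ> l(Suc K := a)) K = mprod (X \<circ> l) K"
      by (rule mprod_cong) auto
    ultimately show "mscale (\<Prod>m\<in>{1..Suc K}. c m ((l(Suc K := a)) m)) (mprod (X \<circ> l(Suc K := a)) (Suc K)) =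
      mscale (\<Prod>m\<in>{1..K}. c m (l m)) (mprod (X \<circ> l) K) ** mscale (c (Suc K) a) (X a)"
      by (simp only: mprod.simps) (simp add: mscale_mult cmat.scale_scale)
  qed
  also have "\<dots> = mprod (\<lambda>m. \<Sum>a\<in>UNIV. mscale (c m a) (X a)) (Suc K)"
    unfolding mprod.simps Suc
    by (simp only: linear_sum[OF linear_matrix_mult_left] linear_sum[OF linear_matrix_mult_right])
      (rule sum.cartesian_product[symmetric])
  finally show ?case ..
qed simp

text \<open>The coefficient \<open>c m\<close> stays attached to its label while the generators are
  permuted, so the same coefficients serve every ordering in a symmetrised tensor.\<close>

lemma mprod_sum_mscale_permuted:
  fixes X :: "'d::finite \<Rightarrow> complex^'n^'n"
  assumes \<pi>: "\<pi> permutes {1..K}"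
  shows "mprod ((\<lambda>m. \<Sum>a\<in>UNIV. mscale (c m a) (X a)) \<circ> \<pi>) K =
    (\<Sum>l\<in>{1..K} \<rightarrow>\<^sub>E UNIV. mscale (\<Prod>m\<in>{1..K}. c m (l m)) (mprod (X \<circ> (l \<circ> \<pi>)) K))"
proof -
  have "mprod ((\<lambda>m. \<Sum>a\<in>UNIV. mscale (c m a) (X a)) \<circ> \<pi>) K =
    (\<Sum>l\<in>{1..K} \<rightarrow>\<^sub>E UNIV. mscale (\<Prod>m\<in>{1..K}. c (\<pi> m) (l m)) (mprod (X \<circ> l) K))"
    using mprod_sum_mscale[of "\<lambda>m. c (\<pi> m)" X K] by (simp only: o_def)
  \<comment> \<open>Relabelling \<open>l\<close> transfers \<pi> from the coefficients to the
    generators; \<open>restrict\<close> keeps the relabelled functions extensional.\<close>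
  also have "\<dots> = (\<Sum>l\<in>{1..K} \<rightarrow>\<^sub>E UNIV. mscale (\<Prod>m\<in>{1..K}. c m (l m)) (mprod (X \<circ> (l \<circ> \<pi>)) K))"
  proof (rule sum.reindex_bij_witness[of _ "\<lambda>l. restrict (l \<circ> \<pi>) {1..K}" "\<lambda>l. restrict (l \<circ> inv \<pi>) {1..K}"])
    fix l :: "nat \<Rightarrow> 'd" assume l: "l \<in> {1..K} \<rightarrow>\<^sub>E UNIV"
    note img = permutes_in_image[OF \<pi>] permutes_in_image[OF permutes_inv[OF \<pi>]]
    note invs = permutes_inverses[OF \<pi>]
    show "restrict (restrict (l \<circ> inv \<pi>) {1..K} \<circ> \<pi>) {1..K} = l"
      "restrict (restrict (l \<circ> \<pi>) {1..K} \<circ> inv \<pi>) {1..K} = l"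
      using l img by (auto simp: fun_eq_iff restrict_def invs PiE_def extensional_def)
    show "restrict (l \<circ> inv \<pi>) {1..K} \<in> {1..K} \<rightarrow>\<^sub>E UNIV" "restrict (l \<circ> \<pi>) {1..K} \<in> {1..K} \<rightarrow>\<^sub>E UNIV"
      by auto
    have "(\<Prod>m\<in>{1..K}. c m (restrict (l \<circ> inv \<pi>) {1..K} m)) = (\<Prod>m\<in>{1..K}. c m (l (inv \<pi> m)))"
      by (rule prod.cong) auto
    also have "\<dots> = (\<Prod>m\<in>{1..K}. c (\<pi> m) (l m))"
      using prod.permute[OF \<pi>, of "\<lambda>m. c m (l (inv \<pi> m))"] by (simp add: o_def invs)
    finally have "(\<Prod>m\<in>{1..K}. c m (restrict (l \<circ> inv \<pi>) {1..K} m)) = (\<Prod>m\<in>{1..K}. c (\<pi> m) (l m))" .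
    moreover have "mprod (X \<circ> (restrict (l \<circ> inv \<pi>) {1..K} \<circ> \<pi>)) K = mprod (X \<circ> l) K"
      using img by (intro mprod_cong) (auto simp: invs)
    ultimately show "mscale (\<Prod>m\<in>{1..K}. c m (restrict (l \<circ> inv \<pi>) {1..K} m))
        (mprod (X \<circ> (restrict (l \<circ> inv \<pi>) {1..K} \<circ> \<pi>)) K) =
      mscale (\<Prod>m\<in>{1..K}. c (\<pi> m) (l m)) (mprod (X \<circ> l) K)"
      by (simp only:)
  qed
  finally show ?thesis .
qed

subsection \<open>Nondegeneracy of the trace form\<close>

lemma subspace_metric_algebra:
  assumes "is_generator_basis \<eta> \<kappa> X"
  shows "cmat.subspace (metric_algebra \<eta>)"
  using assms unfolding is_generator_basis_def by (metis cmat.subspace_span)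

lemma psum_in_metric_algebra:
  assumes "is_generator_basis \<eta> \<kappa> X" "\<And>\<sigma>. T (i \<circ> \<sigma>) \<in> metric_algebra \<eta>"
  shows "psum e N T i \<in> metric_algebra \<eta>"
  unfolding psum_def mscale_of_real[symmetric]
  by (intro cmat.subspace_sum cmat.subspace_scale subspace_metric_algebra[OF assms(1)] assms(2))

lemma trace_transpose_eq: "trace (transpose A) = trace A"
  by (simp add: trace_def transpose_def)

lemma eq_zero_if_trace_mult_zero:
  fixes A :: "complex^'n^'n"
  assumes "\<And>B. trace (A ** B) = 0"
  shows "A = 0"
proof -
  have "A $ r $ s = 0" for r s
  proof -
    \<comment> \<open>The matrix unit for which \<open>trace (A ** E)\<close> is the entry
      \<open>A $ r $ s\<close>.\<close>
    define E :: "complex^'n^'n" where "E = (\<chi> a b. if a = s \<and> b = r then 1 else 0)"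
    have "(\<Sum>b\<in>UNIV. A $ a $ b * E $ b $ a) = (if a = r then A $ r $ s else 0)" for a
    proof -
      have "(\<Sum>b\<in>UNIV. A $ a $ b * E $ b $ a) = (\<Sum>b\<in>UNIV. if b = s then (if a = r then A $ r $ s else 0) else 0)"
        by (rule sum.cong) (auto simp: E_def)
      then show ?thesis by simp
    qed
    then have "trace (A ** E) = A $ r $ s"
      by (simp add: trace_def matrix_matrix_mult_def)
    then show ?thesis using assms by simp
  qed
  then show ?thesis by (simp add: vec_eq_iff)
qed

text \<open>For the involution \<open>B \<mapsto> \<eta> B\<^sup>t \<eta>\<^sup>-\<^sup>1\<close> the metric algebra is the \<open>-1\<close> eigenspace, whose
  trace-orthogonal complement contains the \<open>+1\<close> eigenspace.\<close>

lemma metric_algebra_nondegenerate: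
  fixes A \<eta> :: "complex^'n^'n"
  assumes inv: "invertible \<eta>" and sym: "transpose \<eta> = \<eta> \<or> transpose \<eta> = - \<eta>"
    and A: "A \<in> metric_algebra \<eta>" and orth: "\<And>B. B \<in> metric_algebra \<eta> \<Longrightarrow> trace (A ** B) = 0"
  shows "A = 0"
proof (rule eq_zero_if_trace_mult_zero)
  fix B :: "complex^'n^'n"
  obtain \<mu> where \<mu>: "\<eta> ** \<mu> = mat 1" "\<mu> ** \<eta> = mat 1"
    using inv unfolding invertible_def by blast
  define S where "S = \<eta> ** transpose B ** \<mu>"
  have S_eta: "S ** \<eta> = \<eta> ** transpose B"
    by (simp add: S_def \<mu> flip: matrix_mul_assoc)
  have "transpose (S ** \<eta>) = transpose \<eta> ** transpose S"
    by (rule matrix_transpose_mul)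
  then have "B ** transpose \<eta> = transpose \<eta> ** transpose S"
    unfolding S_eta by (simp add: matrix_transpose_mul)
  then have eta_S: "\<eta> ** transpose S = B ** \<eta>"
    using sym by (auto simp: minus_mult_matrix)
  have eq: "A ** \<eta> = - (\<eta> ** transpose A)"
    using A by (simp add: metric_algebra_def)
  have "transpose (B - S) = transpose B - transpose S"
    by (rule transpose_linear)
  then have "B - S \<in> metric_algebra \<eta>"
    by (simp add: metric_algebra_def matrix_mult_distrib S_eta eta_S)
  then have "trace (A ** (B - S)) = 0" by (rule orth)
  moreover have "trace (A ** S) = - trace (A ** B)"
  proof -
    have "A ** S = A ** \<eta> ** transpose B ** \<mu>"
      by (simp add: S_def matrix_mul_assoc)
    also have "\<dots> = - (\<eta> ** transpose A ** transpose B ** \<mu>)"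
      by (simp add: eq minus_mult_matrix)
    finally have "trace (A ** S) = - trace (\<eta> ** transpose A ** transpose B ** \<mu>)"
      by (simp add: trace_def sum_negf)
    also have "trace (\<eta> ** transpose A ** transpose B ** \<mu>) = trace (\<mu> ** (\<eta> ** transpose A ** transpose B))"
      by (rule trace_mul_sym)
    also have "\<mu> ** (\<eta> ** transpose A ** transpose B) = transpose A ** transpose B"
      by (simp add: matrix_mul_assoc \<mu>)
    also have "\<dots> = transpose (B ** A)"
      by (simp add: matrix_transpose_mul)
    also have "trace \<dots> = trace (A ** B)"
      unfolding trace_transpose_eq by (rule trace_mul_sym)
    finally show ?thesis .
  qed
  ultimately show "trace (A ** B) = 0"
    by (simp add: matrix_mult_distrib trace_sub)
qed

text \<open>If \<kappa> vanished, every generator would be trace-orthogonal to the whole algebra and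
  hence zero by nondegeneracy, contradicting linear independence.\<close>

lemma generator_basis_nonzero:
  fixes X :: "'d::finite \<Rightarrow> complex^'n^'n"
  assumes inv: "invertible \<eta>" and sym: "transpose \<eta> = \<eta> \<or> transpose \<eta> = - \<eta>"
    and basis: "is_generator_basis \<eta> \<kappa> X"
  shows "\<kappa> \<noteq> 0"
proof
  assume "\<kappa> = 0"
  then have zero: "trace (X a ** X b) = 0" for a b
    using basis by (simp add: is_generator_basis_def)
  fix a :: 'd
  have "X a = 0"
  proof (rule metric_algebra_nondegenerate[OF inv sym])
    show "X a \<in> metric_algebra \<eta>"
      using basis by (rule generator_in_metric_algebra)
    fix B assume B: "B \<in> metric_algebra \<eta>"
    have "trace (B ** X a) = 0"
      by (subst generator_expansion[OF basis B]) (simp add: trace_sum_mult mscale_mult trace_mscale zero)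
    then show "trace (X a ** B) = 0"
      by (subst trace_mul_sym)
  qed
  moreover have "X a \<noteq> 0"
    using basis cmat.dependent_zero[of "range X"] unfolding is_generator_basis_def by (metis rangeI)
  ultimately show False by contradiction
qed

subsection \<open>The cocycles as traces\<close>

text \<open>With \<kappa> nonzero the generators form an orthogonal basis for the trace form, and
  coordinates can be read off as traces divided by \<kappa>.\<close>

locale metric_generators =
  fixes \<eta> :: "complex^'n^'n" and \<kappa> :: complex and X :: "'d::finite \<Rightarrow> complex^'n^'n"
  assumes basis: "is_generator_basis \<eta> \<kappa> X" and \<kappa>_nonzero: "\<kappa> \<noteq> 0"
begin

lemmas generator = generator_in_metric_algebra[OF basis]

lemma representation_eq_trace:
  assumes "A \<in> metric_algebra \<eta>"
  shows "cmat.representation (range X) A (X a) = trace (A ** X a) / \<kappa>"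
proof -
  have *: "trace (X k ** X a) = (if k = a then \<kappa> else 0)" for k
    using basis by (simp add: is_generator_basis_def)
  have "trace (A ** X a) = (\<Sum>k\<in>UNIV. cmat.representation (range X) A (X k) * trace (X k ** X a))"
    by (subst generator_expansion[OF basis assms]) (simp add: trace_sum_mult mscale_mult trace_mscale)
  also have "\<dots> = cmat.representation (range X) A (X a) * \<kappa>"
    unfolding * by (simp add: if_distrib[of "\<lambda>x. _ * x"] cong: if_cong)
  finally show ?thesis using \<kappa>_nonzero by simp
qed

lemma trace_expansion:
  assumes "A \<in> metric_algebra \<eta>"
  shows "(\<Sum>k\<in>UNIV. mscale (trace (A ** X k) / \<kappa>) (X k)) = A"
  using generator_expansion[OF basis assms] by (simp only: representation_eq_trace[OF assms])

section \<open>The tensors of the v-family as traces\<close>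

lemma v4_eq_trace: "v4 X a b c d = trace (symprod3 (X a) (X b) (X c) ** X d) / \<kappa>"
  unfolding v4_def by (intro representation_eq_trace symprod3_in_metric_algebra generator)

lemma nested_symprod3_in_metric_algebra:
  "(\<And>m. Y m \<in> metric_algebra \<eta>) \<Longrightarrow> nested_symprod3 m Y \<in> metric_algebra \<eta>"
  by (induction m) (simp_all add: symprod3_in_metric_algebra)

text \<open>The chain lists the coordinates of a nested triple product: the sum over each
  intermediate index reassembles the inner product, which lies in the algebra, from its own
  coordinates.\<close>

lemma v_chain_eq_trace: "v_chain X m w a = trace (nested_symprod3 m (X \<circ> w) ** X a) / \<kappa>"
proof (induction m arbitrary: a)
  case 0
  show ?case
    using basis \<kappa>_nonzero by (simp add: is_generator_basis_def)
next
  case (Suc m)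
  let ?P = "nested_symprod3 m (X \<circ> w)"
  have "?P \<in> metric_algebra \<eta>"
    by (rule nested_symprod3_in_metric_algebra) (simp add: generator)
  then have "?P = (\<Sum>b\<in>UNIV. mscale (v_chain X m w b) (X b))"
    unfolding Suc by (rule trace_expansion[symmetric])
  then have eq: "nested_symprod3 (Suc m) (X \<circ> w) =
      (\<Sum>b\<in>UNIV. mscale (v_chain X m w b) (symprod3 (X b) (X (w (2 * m + 2))) (X (w (2 * m + 3)))))"
    by (simp only: nested_symprod3.simps symprod3_sum_mscale o_apply)
  show ?case
    unfolding eq by (simp add: v4_eq_trace trace_sum_mult mscale_mult trace_mscale sum_divide_distrib)
qed

text \<open>Symmetrisation turns the nested product into \<open>6 ^ (q - 1)\<close> times a plain
  word. Cyclicity of the trace then allows the last generator to be kept fixed; the resulting factor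
  \<open>2 * q\<close> reduces \<open>fact (2 * q)\<close> to
  \<open>fact (2 * q - 1)\<close>.\<close>

lemma v_tensor_eq_trace:
  assumes "1 \<le> q"
  shows "v_tensor X q w = 6 ^ (q - 1) / (\<kappa> * fact (2 * q - 1)) *
    psum 0 (2 * q - 1) (\<lambda>Y. trace (mprod Y (2 * q - 1) ** X (w (2 * q)))) (X \<circ> w)"
proof -
  obtain n where q: "q = Suc n" using assms by (cases q) auto
  let ?K = "2 * n + 1"
  \<comment> \<open>Permuting the indices and permuting the generators that carry them amount to the
    same.\<close>
  have psum_X: "psum 0 M (\<lambda>u. F (X \<circ> u)) u = psum 0 M F (X \<circ> u)" for M F u
    by (simp only: psum_def o_assoc)
  have "(\<Sum>\<pi> | \<pi> permutes {1..2 * q}. v_chain X n (w \<circ> \<pi>) (w (\<pi> (2 * q)))) =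
      psum 0 (Suc ?K) (\<lambda>u. trace (nested_symprod3 n (X \<circ> u) ** X (u (Suc ?K))) / \<kappa>) w"
    by (simp add: psum_def v_chain_eq_trace q)
  also have "\<dots> = psum 0 (Suc ?K) (\<lambda>u. trace (6 ^ n *\<^sub>R mprod (X \<circ> u) ?K ** X (u (Suc ?K))) / \<kappa>) w"
  proof (rule psum_lift[where M = ?K and f = "\<lambda>A u. trace (A ** X (u (Suc ?K))) / \<kappa>"])
    show "psum 0 ?K (\<lambda>u. nested_symprod3 n (X \<circ> u)) u = psum 0 ?K (\<lambda>u. 6 ^ n *\<^sub>R mprod (X \<circ> u) ?K) u" for u
    proof -
      have "psum 0 ?K (\<lambda>u. nested_symprod3 n (X \<circ> u)) u = psum 0 ?K (nested_symprod3 n) (X \<circ> u)"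
        by (rule psum_X)
      also have "\<dots> = 6 ^ n *\<^sub>R psum 0 ?K (\<lambda>Y. mprod Y ?K) (X \<circ> u)"
        by (rule psum_nested_symprod3)
      also have "psum 0 ?K (\<lambda>Y. mprod Y ?K) (X \<circ> u) = psum 0 ?K (\<lambda>u. mprod (X \<circ> u) ?K) u"
        by (rule psum_X[symmetric])
      finally show ?thesis unfolding psum_scaleR .
    qed
    show "linear (\<lambda>A. trace (A ** X (u (Suc ?K))) / \<kappa>)" for u
      using linear_compose[OF linear_trace_mult[of "X (u (Suc ?K))"], of "\<lambda>x. x / \<kappa>"]
      by (simp add: o_def bounded_linear.linear bounded_linear_divide)
  qed (auto simp: permutes_not_in)
  also have "\<dots> = psum 0 (Suc ?K) (\<lambda>u. trace (6 ^ n *\<^sub>R mprod (X \<circ> u) (Suc ?K)) / \<kappa>) w"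
    by (simp add: scalar_matrix_assoc)
  also have "\<dots> = real (Suc ?K) *\<^sub>R psum 0 ?K (\<lambda>u. trace (6 ^ n *\<^sub>R mprod (X \<circ> u) (Suc ?K)) / \<kappa>) w"
    by (rule psum_cyclic) (simp_all only: linear_cmul[OF linear_trace] o_assoc trace_mprod_cyc, simp)
  also have "psum 0 ?K (\<lambda>u. trace (6 ^ n *\<^sub>R mprod (X \<circ> u) (Suc ?K)) / \<kappa>) w =
      psum 0 ?K (\<lambda>u. (6 ^ n / \<kappa>) * trace (mprod (X \<circ> u) ?K ** X (w (Suc ?K)))) w"
    unfolding linear_cmul[OF linear_trace]
    by (rule psum_cong) (simp add: permutes_not_in scaleR_conv_of_real)
  also have "\<dots> = (6 ^ n / \<kappa>) * psum 0 ?K (\<lambda>Y. trace (mprod Y ?K ** X (w (Suc ?K)))) (X \<circ> w)"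
    unfolding psum_X[of _ "\<lambda>Y. trace (mprod Y ?K ** X (w (Suc ?K)))", symmetric]
    by (rule psum_linear) (rule bounded_linear.linear[OF bounded_linear_mult_right])
  finally have sum_eq: "(\<Sum>\<pi> | \<pi> permutes {1..2 * q}. v_chain X n (w \<circ> \<pi>) (w (\<pi> (2 * q)))) =
    real (Suc ?K) *\<^sub>R ((6 ^ n / \<kappa>) * psum 0 ?K (\<lambda>Y. trace (mprod Y ?K ** X (w (Suc ?K)))) (X \<circ> w))" .
  have q': "q - 1 = n" "2 * q - 1 = ?K" "2 * q = Suc ?K" using q by simp_all
  have fact_eq: "fact (Suc ?K) = of_nat (Suc ?K) * (fact ?K :: complex)" by (rule fact_Suc)
  have cancel: "real k *\<^sub>R (a / \<kappa> * S) / (of_nat k * f) = a / (\<kappa> * f) * S" if "k \<noteq> 0" for k a S f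
    using that by (simp add: scaleR_conv_of_real)
  show ?thesis
    unfolding v_tensor_def q'(1) sum_eq unfolding q' fact_eq diff_Suc_1 by (rule cancel) simp
qed

section \<open>The cocycles as alternating traces of commutators\<close>

lemma sum_struct_const_mprod:
  assumes "\<pi> permutes {1..K}"
  shows "(\<Sum>l\<in>{1..K} \<rightarrow>\<^sub>E UNIV. (\<Prod>m\<in>{1..K}. struct_const X (j (2 * m - 1)) (j (2 * m)) (l m)) *
      trace (mprod (X \<circ> (l \<circ> \<pi>)) K ** B)) = trace (mprod (pair_comm X j \<circ> \<pi>) K ** B)"
proof -
  have "pair_comm X j = (\<lambda>m. \<Sum>a\<in>UNIV. mscale (struct_const X (j (2 * m - 1)) (j (2 * m)) a) (X a))"
    by (rule ext) (simp only: pair_comm_def comm_eq_struct_const[OF basis])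
  then show ?thesis
    by (simp only: mprod_sum_mscale_permuted[OF assms] trace_sum_mult mscale_mult trace_mscale)
qed

text \<open>Contraction with the structure constants replaces the generators in
  \<open>v_tensor_eq_trace\<close> by commutators. Under alternation all \<open>(2 * q - 1)!\<close>
  orderings of these agree, which cancels the factorial of the symmetrisation.\<close>

lemma Omega_eq_alternated_pair_comm:
  assumes q: "1 \<le> q"
  shows "Omega X q i = 6 ^ (q - 1) / (\<kappa> * fact (4 * q - 1)) *
    psum 1 (4 * q - 1) (\<lambda>j. trace (mprod (pair_comm X j) (2 * q - 1) ** X (j (4 * q - 1)))) i"
proof -
  let ?K = "2 * q - 1" and ?N = "4 * q - 1"
  let ?c = "6 ^ (q - 1) / (\<kappa> * fact ?K)"
  have le: "2 * ?K \<le> ?N" using q by simp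
  define T where "T j = (\<Sum>l \<in> {1..?K} \<rightarrow>\<^sub>E UNIV.
      (\<Prod>m\<in>{1..?K}. struct_const X (j (2 * m - 1)) (j (2 * m)) (l m)) *
      v_tensor X q (l(2 * q := j ?N)))" for j
  have T: "T j = ?c * (\<Sum>\<pi> | \<pi> permutes {1..?K}. trace (mprod (pair_comm X j \<circ> \<pi>) ?K ** X (j ?N)))" for j
  proof -
    have "v_tensor X q (l(2 * q := j ?N)) =
        ?c * (\<Sum>\<pi> | \<pi> permutes {1..?K}. trace (mprod (X \<circ> (l \<circ> \<pi>)) ?K ** X (j ?N)))"
      for l :: "nat \<Rightarrow> 'd"
    proof -
      have "mprod (X \<circ> l(2 * q := j ?N) \<circ> \<pi>) ?K = mprod (X \<circ> (l \<circ> \<pi>)) ?K"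
        if "\<pi> permutes {1..?K}" for \<pi>
      proof (rule mprod_cong)
        fix m assume "m \<in> {1..?K}"
        then have "\<pi> m \<in> {1..?K}" by (simp only: permutes_in_image[OF that])
        then have "\<pi> m \<noteq> 2 * q" using q by auto
        then show "(X \<circ> l(2 * q := j ?N) \<circ> \<pi>) m = (X \<circ> (l \<circ> \<pi>)) m" by simp
      qed
      then have "psum 0 ?K (\<lambda>Y. trace (mprod Y ?K ** X (j ?N))) (X \<circ> l(2 * q := j ?N)) =
          (\<Sum>\<pi> | \<pi> permutes {1..?K}. trace (mprod (X \<circ> (l \<circ> \<pi>)) ?K ** X (j ?N)))"
        unfolding psum_def by (intro sum.cong refl) simp
      then show ?thesis
        unfolding v_tensor_eq_trace[OF q] by simp
    qed
    then have "T j = (\<Sum>l \<in> {1..?K} \<rightarrow>\<^sub>E UNIV.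
      (\<Prod>m\<in>{1..?K}. struct_const X (j (2 * m - 1)) (j (2 * m)) (l m)) *
        (?c * (\<Sum>\<pi> | \<pi> permutes {1..?K}. trace (mprod (X \<circ> (l \<circ> \<pi>)) ?K ** X (j ?N)))))"
      by (simp only: T_def)
    also have "\<dots> = ?c * (\<Sum>l \<in> {1..?K} \<rightarrow>\<^sub>E UNIV. \<Sum>\<pi> | \<pi> permutes {1..?K}.
      (\<Prod>m\<in>{1..?K}. struct_const X (j (2 * m - 1)) (j (2 * m)) (l m)) *
        trace (mprod (X \<circ> (l \<circ> \<pi>)) ?K ** X (j ?N)))"
      by (simp only: mult.left_commute[of _ ?c] flip: sum_distrib_left)
    also have "\<dots> = ?c * (\<Sum>\<pi> | \<pi> permutes {1..?K}. trace (mprod (pair_comm X j \<circ> \<pi>) ?K ** X (j ?N)))"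
      by (subst sum.swap, intro arg_cong[where f = "\<lambda>x. ?c * x"] sum.cong refl)
        (rule sum_struct_const_mprod, simp only: mem_Collect_eq)
    finally show ?thesis .
  qed
  have "Omega X q i = psum 1 ?N T i / fact ?N"
    unfolding Omega_def T_def
  proof (subst sum_gen_kronecker)
    fix j j' :: "nat \<Rightarrow> 'd"
    assume eq: "\<And>m. m \<in> {1..?N} \<Longrightarrow> j m = j' m"
    have "j (2 * m - 1) = j' (2 * m - 1) \<and> j (2 * m) = j' (2 * m)" if "m \<in> {1..?K}" for m
      using that le by (intro conjI eq) auto
    moreover have "j ?N = j' ?N" using q by (intro eq) auto
    ultimately show "(\<Sum>l \<in> {1..?K} \<rightarrow>\<^sub>E UNIV.
        (\<Prod>m\<in>{1..?K}. struct_const X (j (2 * m - 1)) (j (2 * m)) (l m)) * v_tensor X q (l(2 * q := j ?N))) =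
      (\<Sum>l \<in> {1..?K} \<rightarrow>\<^sub>E UNIV.
        (\<Prod>m\<in>{1..?K}. struct_const X (j' (2 * m - 1)) (j' (2 * m)) (l m)) * v_tensor X q (l(2 * q := j' ?N)))"
      by (intro sum.cong arg_cong2[where f = "(*)"] prod.cong refl) simp_all
  qed simp
  also have "psum 1 ?N T i = ?c * (\<Sum>\<pi> | \<pi> permutes {1..?K}.
      psum 1 ?N (\<lambda>j. trace (mprod (pair_comm X j \<circ> \<pi>) ?K ** X (j ?N))) i)"
    unfolding T psum_sum[symmetric]
    by (rule psum_linear) (rule bounded_linear.linear[OF bounded_linear_mult_right])
  also have "\<dots> = ?c * (\<Sum>\<pi> | \<pi> permutes {1..?K}.
      psum 1 ?N (\<lambda>j. trace (mprod (pair_comm X j) ?K ** X (j ?N))) i)"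
  proof (intro arg_cong[where f = "\<lambda>x. _ * x"] sum.cong refl, unfold mem_Collect_eq)
    fix \<pi> assume \<pi>: "\<pi> permutes {1..?K}"
    show "psum 1 ?N (\<lambda>j. trace (mprod (pair_comm X j \<circ> \<pi>) ?K ** X (j ?N))) i =
      psum 1 ?N (\<lambda>j. trace (mprod (pair_comm X j) ?K ** X (j ?N))) i"
    proof (rule psum_lift[where M = "2 * ?K" and f = "\<lambda>A j. trace (A ** X (j ?N))",
        OF le psum_pair_comm_permute[OF \<pi>] linear_trace_mult])
      fix A and j :: "nat \<Rightarrow> 'd" and \<sigma>
      assume "\<sigma> permutes {1..2 * ?K}"
      then have "\<sigma> ?N = ?N"
        using q by (elim permutes_not_in) auto
      then show "trace (A ** X ((j \<circ> \<sigma>) ?N)) = trace (A ** X (j ?N))" by simp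
    qed
  qed
  finally show ?thesis
    by (simp add: card_permutations[of _ ?K])
qed

text \<open>The coefficients of the \<open>K\<close>-th power of the matrix of two-forms built from
  commutators, without the factor \<open>1 / (2 * K)!\<close>.\<close>

definition pair_comm_form :: "nat \<Rightarrow> (nat \<Rightarrow> 'd) \<Rightarrow> complex^'n^'n"
  where "pair_comm_form K = psum 1 (2 * K) (\<lambda>j. mprod (pair_comm X j) K)"

text \<open>An odd product of algebra elements need not lie in the algebra, but nested triple
  products do. Since the commutators may be reordered under alternation, the form is a multiple of
  an alternated, symmetrised nested triple product.\<close>

lemma pair_comm_form_in_metric_algebra: "pair_comm_form (2 * m + 1) i \<in> metric_algebra \<eta>"
proof -
  let ?K = "2 * m + 1"
  have "(\<Sum>\<pi> | \<pi> permutes {1..?K}. psum 1 (2 * ?K) (\<lambda>j. mprod (pair_comm X j \<circ> \<pi>) ?K) i) =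
      (\<Sum>\<pi> | \<pi> permutes {1..?K}. pair_comm_form ?K i)"
    unfolding pair_comm_form_def by (intro sum.cong refl psum_pair_comm_permute) simp
  also have "\<dots> = fact ?K *\<^sub>R pair_comm_form ?K i"
    using card_permutations[of "{1..?K}" ?K]
    by (simp only: sum_constant_scaleR card_atLeastAtMost finite_atLeastAtMost diff_Suc_1 add_Suc_right of_nat_fact)
  finally have "fact ?K *\<^sub>R pair_comm_form ?K i =
      (\<Sum>\<pi> | \<pi> permutes {1..?K}. psum 1 (2 * ?K) (\<lambda>j. mprod (pair_comm X j \<circ> \<pi>) ?K) i)" ..
  also have "\<dots> = psum 1 (2 * ?K) (\<lambda>j. psum 0 ?K (\<lambda>Y. mprod Y ?K) (pair_comm X j)) i"
    unfolding psum_sum[symmetric] by (simp only: psum_def[of 0] power_0 of_int_1 scaleR_one)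
  finally have "(6 ^ m * fact ?K) *\<^sub>R pair_comm_form ?K i =
      6 ^ m *\<^sub>R psum 1 (2 * ?K) (\<lambda>j. psum 0 ?K (\<lambda>Y. mprod Y ?K) (pair_comm X j)) i"
    by (simp only: flip: scaleR_scaleR)
  also have "\<dots> = psum 1 (2 * ?K) (\<lambda>j. psum 0 ?K (nested_symprod3 m) (pair_comm X j)) i"
    unfolding psum_nested_symprod3 by (rule psum_scaleR[symmetric])
  finally have eq: "(6 ^ m * fact ?K) *\<^sub>R pair_comm_form ?K i =
      psum 1 (2 * ?K) (\<lambda>j. psum 0 ?K (nested_symprod3 m) (pair_comm X j)) i" .
  have "pair_comm X j a \<in> metric_algebra \<eta>" for j a
    unfolding pair_comm_def by (intro comm_in_metric_algebra generator)
  then have "nested_symprod3 m (pair_comm X j \<circ> \<sigma>) \<in> metric_algebra \<eta>" for j \<sigma>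
    by (intro nested_symprod3_in_metric_algebra) simp
  then have mem: "(6 ^ m * fact ?K) *\<^sub>R pair_comm_form ?K i \<in> metric_algebra \<eta>"
    unfolding eq by (intro psum_in_metric_algebra[OF basis])
  have "pair_comm_form ?K i = (1 / (6 ^ m * fact ?K)) *\<^sub>R (6 ^ m * fact ?K) *\<^sub>R pair_comm_form ?K i"
    by simp
  also have "\<dots> \<in> metric_algebra \<eta>"
    unfolding mscale_of_real[of "1 / _", symmetric]
    by (intro cmat.subspace_scale subspace_metric_algebra[OF basis] mem)
  finally show ?thesis .
qed

text \<open>Leaves the last index open. Written in generators, the trace has a word of odd length
  \<open>4 * q - 1\<close>, whose cyclic shift is even, so \<open>psum_cyclic\<close> fixes the last
  position; the factor \<open>4 * q - 1\<close> reduces the factorial to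
  \<open>fact (4 * q - 2)\<close>.\<close>

lemma Omega_eq_pair_comm_form:
  assumes q: "1 \<le> q"
  shows "Omega X q i = 6 ^ (q - 1) / (\<kappa> * fact (4 * q - 2)) *
    trace (pair_comm_form (2 * q - 1) i ** X (i (4 * q - 1)))"
proof -
  let ?K = "2 * q - 1"
  have N: "4 * q - 1 = Suc (2 * ?K)" "4 * q - 2 = 2 * ?K" using q by simp_all
  \<comment> \<open>Stated for general \<open>N\<close> because it is used twice: for all positions,
    and backwards once the last position has been fixed.\<close>
  have to_word: "psum 1 N (\<lambda>j. trace (mprod (pair_comm X j) ?K ** X (j (Suc (2 * ?K))))) i =
    psum 1 N (\<lambda>j. 2 ^ ?K *\<^sub>R trace (mprod (X \<circ> j) (Suc (2 * ?K)))) i" if "2 * ?K \<le> N" for N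
  proof -
    have "psum 1 N (\<lambda>j. trace (mprod (pair_comm X j) ?K ** X (j (Suc (2 * ?K))))) i =
      psum 1 N (\<lambda>j. trace (2 ^ ?K *\<^sub>R mprod (X \<circ> j) (2 * ?K) ** X (j (Suc (2 * ?K))))) i"
    proof (rule psum_lift[where M = "2 * ?K" and f = "\<lambda>A j. trace (A ** X (j (Suc (2 * ?K))))"])
      show "psum 1 (2 * ?K) (\<lambda>j. mprod (pair_comm X j) ?K) j =
          psum 1 (2 * ?K) (\<lambda>j. 2 ^ ?K *\<^sub>R mprod (X \<circ> j) (2 * ?K)) j" for j
        unfolding psum_scaleR by (rule psum_pair_comm)
    qed (use that in \<open>simp_all add: linear_trace_mult permutes_not_in\<close>)
    then show ?thesis
      by (simp only: mprod.simps o_apply linear_cmul[OF linear_trace_mult])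
  qed
  have "psum 1 (Suc (2 * ?K)) (\<lambda>j. trace (mprod (pair_comm X j) ?K ** X (j (Suc (2 * ?K))))) i =
    psum 1 (Suc (2 * ?K)) (\<lambda>j. 2 ^ ?K *\<^sub>R trace (mprod (X \<circ> j) (Suc (2 * ?K)))) i"
    by (rule to_word) simp
  also have "\<dots> = real (Suc (2 * ?K)) *\<^sub>R psum 1 (2 * ?K) (\<lambda>j. 2 ^ ?K *\<^sub>R trace (mprod (X \<circ> j) (Suc (2 * ?K)))) i"
    by (rule psum_cyclic) (simp_all only: o_assoc trace_mprod_cyc, simp)
  also have "psum 1 (2 * ?K) (\<lambda>j. 2 ^ ?K *\<^sub>R trace (mprod (X \<circ> j) (Suc (2 * ?K)))) i =
      psum 1 (2 * ?K) (\<lambda>j. trace (mprod (pair_comm X j) ?K ** X (j (Suc (2 * ?K))))) i"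
    by (rule to_word[symmetric]) simp
  also have "\<dots> = psum 1 (2 * ?K) (\<lambda>j. trace (mprod (pair_comm X j) ?K ** X (i (Suc (2 * ?K))))) i"
    by (rule psum_cong) (simp add: permutes_not_in)
  also have "\<dots> = trace (pair_comm_form ?K i ** X (i (Suc (2 * ?K))))"
    unfolding pair_comm_form_def by (rule psum_linear) (rule linear_trace_mult)
  finally show ?thesis
    unfolding Omega_eq_alternated_pair_comm[OF q] N by (simp add: scaleR_conv_of_real field_simps del: of_nat_Suc)
qed

lemma pair_comm_form_cong:
  assumes "\<And>m. m \<in> {1..2 * K} \<Longrightarrow> j m = j' m"
  shows "pair_comm_form K j = pair_comm_form K j'"
  unfolding pair_comm_form_def psum_def
proof (intro sum.cong refl arg_cong[where f = "\<lambda>A. _ *\<^sub>R A"] mprod_cong, unfold mem_Collect_eq)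
  fix \<sigma> m assume \<sigma>: "\<sigma> permutes {1..2 * K}" and m: "m \<in> {1..K}"
  then have "2 * m - 1 \<in> {1..2 * K}" "2 * m \<in> {1..2 * K}" by auto
  then have "\<sigma> (2 * m - 1) \<in> {1..2 * K}" "\<sigma> (2 * m) \<in> {1..2 * K}"
    by (simp_all only: permutes_in_image[OF \<sigma>])
  then show "pair_comm X (j \<circ> \<sigma>) m = pair_comm X (j' \<circ> \<sigma>) m"
    by (simp only: pair_comm_def o_apply assms)
qed

section \<open>Contraction of the lower cocycle with the four-index tensor\<close>

lemma sum_v4_eq_trace_symprod3:
  "(\<Sum>s\<in>UNIV. \<Sum>a\<in>UNIV. \<Sum>b\<in>UNIV. t s * f a * g b * v4 X s a b d) =
    trace (symprod3 (\<Sum>s\<in>UNIV. mscale (t s) (X s)) (\<Sum>a\<in>UNIV. mscale (f a) (X a))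
      (\<Sum>b\<in>UNIV. mscale (g b) (X b)) ** X d) / \<kappa>"
proof -
  have 2: "symprod3 A (\<Sum>a\<in>UNIV. mscale (f a) (X a)) C = (\<Sum>a\<in>UNIV. mscale (f a) (symprod3 A (X a) C))" for A C
    by (simp only: symprod3_commute(1)[of A] symprod3_sum_mscale)
  have 3: "symprod3 A B (\<Sum>b\<in>UNIV. mscale (g b) (X b)) = (\<Sum>b\<in>UNIV. mscale (g b) (symprod3 A B (X b)))" for A B
    by (simp only: symprod3_commute(2)[of A] symprod3_sum_mscale)
  show ?thesis
    unfolding symprod3_sum_mscale unfolding 2 unfolding 3 v4_eq_trace
    by (simp add: trace_sum_mult mscale_mult trace_mscale sum_distrib_left sum_divide_distrib mult.assoc)
qed

lemma trace_sum_list_mult: "trace ((\<Sum>x\<leftarrow>xs. F x) ** B) = (\<Sum>x\<leftarrow>xs. trace (F x ** B))"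
  for B :: "complex^'n^'n"
  by (induction xs) (simp_all add: linear_0[OF linear_trace] linear_add[OF linear_trace_mult])

text \<open>As a function of \<open>s\<close>, the lower cocycle gives the coordinates of an odd
  \<open>pair_comm_form\<close> up to a constant. That form lies in the algebra, so the sum over
  \<open>s\<close> recovers it, while the sums over \<open>l\<^sub>1\<close> and
  \<open>l\<^sub>2\<close> recover two commutators.\<close>

lemma contraction_eq_trace:
  assumes p: "2 \<le> p"
  shows "(\<Sum>s\<in>UNIV. \<Sum>l\<^sub>1\<in>UNIV. \<Sum>l\<^sub>2\<in>UNIV.
      Omega X (p - 1) (j(4 * p - 5 := s)) *
      struct_const X (j (4 * p - 5)) (j (4 * p - 4)) l\<^sub>1 *
      struct_const X (j (4 * p - 3)) (j (4 * p - 2)) l\<^sub>2 *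
      v4 X s l\<^sub>1 l\<^sub>2 (j (4 * p - 1))) =
    6 ^ (p - 2) / (\<kappa> * fact (4 * p - 6)) *
    trace (symprod3 (pair_comm_form (2 * p - 3) j) (pair_comm X j (2 * p - 2)) (pair_comm X j (2 * p - 1)) **
      X (j (4 * p - 1)))"
proof -
  let ?c = "6 ^ (p - 2) / fact (4 * p - 6) :: complex" and ?W = "pair_comm_form (2 * p - 3) j"
  have "2 * p - 3 = 2 * (p - 2) + 1" using p by simp
  then have W: "?W \<in> metric_algebra \<eta>"
    by (simp only: pair_comm_form_in_metric_algebra)
  have Omega: "Omega X (p - 1) (j(4 * p - 5 := s)) = ?c * (trace (?W ** X s) / \<kappa>)" for s
  proof -
    have eq: "p - 1 - 1 = p - 2" "2 * (p - 1) - 1 = 2 * p - 3" "4 * (p - 1) - 1 = 4 * p - 5"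
      "4 * (p - 1) - 2 = 4 * p - 6"
      using p by simp_all
    \<comment> \<open>The form reads positions up to \<open>2 * (2 * p - 3) = 4 * p - 6\<close>
      only, so placing \<open>s\<close> at position \<open>4 * p - 5\<close> does not affect it. The
      structure constants still use the original \<open>j (4 * p - 5)\<close>.\<close>
    have W_upd: "pair_comm_form (2 * p - 3) (j(4 * p - 5 := s)) = ?W"
      using p by (intro pair_comm_form_cong) auto
    have "1 \<le> p - 1" using p by simp
    show ?thesis
      unfolding Omega_eq_pair_comm_form[OF \<open>1 \<le> p - 1\<close>] eq unfolding W_upd by (simp add: mult.commute)
  qed
  have sum_W: "(\<Sum>s\<in>UNIV. mscale (?c * (trace (?W ** X s) / \<kappa>)) (X s)) = mscale ?c ?W"
    using trace_expansion[OF W]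
    by (simp only: cmat.scale_scale[symmetric] cmat.scale_sum_right[symmetric])
  have pair1: "pair_comm X j (2 * p - 2) =
      (\<Sum>a\<in>UNIV. mscale (struct_const X (j (4 * p - 5)) (j (4 * p - 4)) a) (X a))"
  proof -
    have "2 * (2 * p - 2) - 1 = 4 * p - 5" "2 * (2 * p - 2) = 4 * p - 4" using p by simp_all
    then show ?thesis by (simp only: pair_comm_def comm_eq_struct_const[OF basis])
  qed
  have pair2: "pair_comm X j (2 * p - 1) =
      (\<Sum>a\<in>UNIV. mscale (struct_const X (j (4 * p - 3)) (j (4 * p - 2)) a) (X a))"
  proof -
    have "2 * (2 * p - 1) - 1 = 4 * p - 3" "2 * (2 * p - 1) = 4 * p - 2" using p by simp_all
    then show ?thesis by (simp only: pair_comm_def comm_eq_struct_const[OF basis])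
  qed
  have scale: "trace (symprod3 (mscale c A) B C ** D) = c * trace (symprod3 A B C ** D)" for c A B C D
    using symprod3_sum_mscale[of "\<lambda>_. c" "\<lambda>_. A" "{()}" B C]
    by (simp add: mscale_mult trace_mscale)
  show ?thesis
    unfolding Omega sum_v4_eq_trace_symprod3 sum_W scale pair1 pair2 by simp
qed

text \<open>Under the outer alternation the inner one costs \<open>fact (4 * p - 6)\<close>, which
  cancels, and the six orderings of the triple product agree. The factor 6 raises
  \<open>6 ^ (p - 2)\<close> to \<open>6 ^ (p - 1)\<close>, matching
  \<open>Omega_eq_alternated_pair_comm\<close>.\<close>

lemma Omega_recursion:
  assumes p: "2 \<le> p"
  shows "Omega X p i =
    (\<Sum>j \<in> {1..4 * p - 1} \<rightarrow>\<^sub>E UNIV.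
       gen_kronecker (4 * p - 1) i j *
       (\<Sum>s\<in>UNIV. \<Sum>l\<^sub>1\<in>UNIV. \<Sum>l\<^sub>2\<in>UNIV.
          Omega X (p - 1) (j(4 * p - 5 := s)) *
          struct_const X (j (4 * p - 5)) (j (4 * p - 4)) l\<^sub>1 *
          struct_const X (j (4 * p - 3)) (j (4 * p - 2)) l\<^sub>2 *
          v4 X s l\<^sub>1 l\<^sub>2 (j (4 * p - 1))))
    / fact (4 * p - 1)"
proof -
  \<comment> \<open>This substitution removes all truncated subtractions from the index
    arithmetic.\<close>
  obtain n where n: "p = n + 2"
    using p by (metis add.commute le_Suc_ex)
  let ?M = "2 * (2 * n + 1)" and ?N = "4 * n + 7"
  have p1: "1 \<le> p" using p by simp
  have nums: "4 * p - 1 = ?N" "4 * p - 6 = ?M" "2 * p - 3 = 2 * n + 1" "2 * p - 2 = 2 * n + 1 + 1"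
    "2 * p - 1 = 2 * n + 1 + 2" "p - 2 = n" "p - 1 = Suc n"
    using n by simp_all
  let ?f = "\<lambda>A j. trace (symprod3 A (pair_comm X j (2 * n + 1 + 1)) (pair_comm X j (2 * n + 1 + 2)) ** X (j ?N))"
  let ?c = "6 ^ n / (\<kappa> * fact ?M)"
  let ?T = "\<lambda>j. trace (mprod (pair_comm X j) (2 * n + 1 + 2) ** X (j ?N))"
  have cong: "?f (pair_comm_form (2 * n + 1) j) j = ?f (pair_comm_form (2 * n + 1) j') j'"
    if "\<And>m. m \<in> {1..?N} \<Longrightarrow> j m = j' m" for j j'
  proof -
    have "pair_comm_form (2 * n + 1) j = pair_comm_form (2 * n + 1) j'"
      using that by (intro pair_comm_form_cong) auto
    moreover have "pair_comm X j m = pair_comm X j' m" if "m \<in> {2 * n + 1 + 1, 2 * n + 1 + 2}" for m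
      using that \<open>\<And>m. m \<in> {1..?N} \<Longrightarrow> j m = j' m\<close> by (auto simp: pair_comm_def)
    moreover have "j ?N = j' ?N" using that by simp
    ultimately show ?thesis by simp
  qed
  have linear_f: "linear (\<lambda>A. ?f A j)" for j
    using linear_compose[OF linear_symprod3 linear_trace_mult] by (simp add: o_def)
  have "psum 1 ?N (\<lambda>j. ?f (pair_comm_form (2 * n + 1) j) j) i =
      psum 1 ?N (\<lambda>j. ?f (fact ?M *\<^sub>R mprod (pair_comm X j) (2 * n + 1)) j) i"
  proof (rule psum_lift[where M = ?M and f = ?f, OF _ _ linear_f])
    show "psum 1 ?M (pair_comm_form (2 * n + 1)) j = psum 1 ?M (\<lambda>j. fact ?M *\<^sub>R mprod (pair_comm X j) (2 * n + 1)) j" for j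
      unfolding pair_comm_form_def psum_scaleR by (rule psum_psum) simp
    fix A j \<sigma> assume "\<sigma> permutes {1..?M}"
    then have "\<sigma> m = m" if "?M < m" for m
      using that by (elim permutes_not_in) auto
    then show "?f A (j \<circ> \<sigma>) = ?f A j"
      by (simp add: pair_comm_def)
  qed simp
  also have "\<dots> = fact ?M *\<^sub>R psum 1 ?N (\<lambda>j. ?f (mprod (pair_comm X j) (2 * n + 1)) j) i"
    unfolding linear_cmul[OF linear_f] by (rule psum_scaleR)
  \<comment> \<open>The two outer commutators are the next factors of the same product, so the
    triple product consists of six orderings of one word in \<open>2 * n + 3\<close>
    commutators.\<close>
  also have "psum 1 ?N (\<lambda>j. ?f (mprod (pair_comm X j) (2 * n + 1)) j) i =
      psum 1 ?N (\<lambda>j. \<Sum>\<rho>\<leftarrow>orderings3 (2 * n + 1). trace (mprod (pair_comm X j \<circ> \<rho>) (2 * n + 1 + 2) ** X (j ?N))) i"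
    unfolding symprod3_mprod trace_sum_list_mult ..
  also have "\<dots> = 6 *\<^sub>R psum 1 ?N ?T i"
  proof (rule psum_orderings3)
    fix \<rho> assume "\<rho> \<in> set (orderings3 (2 * n + 1))"
    from orderings3_permutes[OF this] have \<rho>: "\<rho> permutes {1..2 * n + 1 + 2}" .
    show "psum 1 ?N (\<lambda>j. trace (mprod (pair_comm X j \<circ> \<rho>) (2 * n + 1 + 2) ** X (j ?N))) i = psum 1 ?N ?T i"
    proof (rule psum_lift[where M = "2 * (2 * n + 1 + 2)" and f = "\<lambda>A j. trace (A ** X (j ?N))",
        OF _ psum_pair_comm_permute[OF \<rho>] linear_trace_mult])
      fix A and j :: "nat \<Rightarrow> 'd" and \<sigma> assume "\<sigma> permutes {1..2 * (2 * n + 1 + 2)}"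
      then have "\<sigma> ?N = ?N" by (elim permutes_not_in) auto
      then show "trace (A ** X ((j \<circ> \<sigma>) ?N)) = trace (A ** X (j ?N))" by simp
    qed simp
  qed
  finally have form: "psum 1 ?N (\<lambda>j. ?f (pair_comm_form (2 * n + 1) j) j) i =
      fact ?M *\<^sub>R 6 *\<^sub>R psum 1 ?N ?T i" .
  have "psum 1 ?N (\<lambda>j. ?c * ?f (pair_comm_form (2 * n + 1) j) j) i =
      ?c * psum 1 ?N (\<lambda>j. ?f (pair_comm_form (2 * n + 1) j) j) i"
    by (rule psum_linear) (rule bounded_linear.linear[OF bounded_linear_mult_right])
  also have "\<dots> = 6 ^ Suc n / \<kappa> * psum 1 ?N ?T i"
    unfolding form by (simp add: scaleR_conv_of_real del: fact_Suc)
  finally have "psum 1 ?N (\<lambda>j. ?c * ?f (pair_comm_form (2 * n + 1) j) j) i / fact ?N =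
      6 ^ Suc n / (\<kappa> * fact ?N) * psum 1 ?N ?T i"
    by simp
  also have "\<dots> = Omega X p i"
    unfolding Omega_eq_alternated_pair_comm[OF p1] nums ..
  finally show ?thesis
    unfolding contraction_eq_trace[OF p] unfolding nums
    by (subst sum_gen_kronecker) (rule arg_cong[where f = "\<lambda>x. ?c * x"], rule cong, assumption, simp)
qed

end

theorem lemma7p2:
  fixes \<eta> :: "complex^'n^'n" and \<kappa> :: complex
    and X :: "'d::finite \<Rightarrow> complex^'n^'n"
    and l p :: nat and i :: "nat \<Rightarrow> 'd"
  assumes "(is_euclidean_metric \<eta> \<and> CARD('n) = 2 * l + 1 \<and> 2 \<le> l \<and> 2 \<le> p \<and> p \<le> l) \<or>
           (is_symplectic_metric \<eta> \<and> CARD('n) = 2 * l \<and> 3 \<le> l \<and> 2 \<le> p \<and> p \<le> l) \<or>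
           (is_euclidean_metric \<eta> \<and> CARD('n) = 2 * l \<and> 4 \<le> l \<and> 2 \<le> p \<and> p \<le> l - 1)"
    and "is_generator_basis \<eta> \<kappa> X"
  shows "Omega X p i =
    (\<Sum>j \<in> {1..4 * p - 1} \<rightarrow>\<^sub>E UNIV.
       gen_kronecker (4 * p - 1) i j *
       (\<Sum>s\<in>UNIV. \<Sum>l\<^sub>1\<in>UNIV. \<Sum>l\<^sub>2\<in>UNIV.
          Omega X (p - 1) (j(4 * p - 5 := s)) *
          struct_const X (j (4 * p - 5)) (j (4 * p - 4)) l\<^sub>1 *
          struct_const X (j (4 * p - 3)) (j (4 * p - 2)) l\<^sub>2 *
          v4 X s l\<^sub>1 l\<^sub>2 (j (4 * p - 1))))
    / fact (4 * p - 1)"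
proof -
  have p: "2 \<le> p" using assms(1) by blast
  have "invertible (mat 1 :: complex^'n^'n)"
    unfolding invertible_def by (auto intro: exI[of _ "mat 1"])
  \<comment> \<open>In each of the three cases the metric is nondegenerate and either symmetric or
    antisymmetric, which yields a nonzero \<kappa>.\<close>
  then have "invertible \<eta>" "transpose \<eta> = \<eta> \<or> transpose \<eta> = - \<eta>"
    using assms(1) by (auto simp: is_euclidean_metric_def is_symplectic_metric_def)
  then interpret metric_generators \<eta> \<kappa> X
    using assms(2) generator_basis_nonzero by unfold_locales blast+
  show ?thesis by (rule Omega_recursion[OF p])
qed

end
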